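(* Let $q>0$ and $\pi\in\mathbb{L}^2(\mu_0\otimes\mu_0)$. There exists $F^\mu\in\mathbb{L}^2(\mu_0\otimes\rho)$ such that $(F^\mu,\pi)$ is a mean field equilibrium for the mean-variance criterion with parameter $q$ and such that the Fredholm equation $$\big(1+\widehat{\mathbb{E}}^{\mu_0}[\pi(\widehat X_0,X_0)]\big)F(X_0,\varepsilon^0)=b(X_0)+\sigma^0(X_0)\varepsilon^0+\widehat{\mathbb{E}}^{\mu_0}\big[\pi(X_0,\widehat X_0)F(\widehat X_0,\varepsilon^0)\big]\qquad(\ast)$$ has a unique solution $F$, if and only if $$\mathbb{E}[b(X_0)]>0\quad\text{and}\quad\sigma^0=\lambda b\ \ \mu_0\text{-a.s., with }\lambda=\sqrt{\tfrac{q}{\mathbb{E}[b(X_0)]}}\ \text{ or }\ \lambda=-\sqrt{\tfrac{q}{\mathbb{E}[b(X_0)]}},$$ and the strategy $\pi$ induces uniqueness for the Fredholm equation $(\ast)$ and satisfies $$0\neq\widehat{\mathbb{E}}^{\mu_0}\big[\pi(X_0,\widehat X_0)\big]+\frac{b(X_0)}{\mathbb{E}[b(X_0)]}=1+\widehat{\mathbb{E}}^{\mu_0}\big[\pi(\widehat X_0,X_0)\big],\quad\mu_0\text{-a.s.}$$ In this case, $F^\mu$ is explicitly given by $$F^\mu(X_0,\varepsilon^0)=\mathbb{E}[b(X_0)]\,(1+\lambda\varepsilon^0),\quad\mu_0\otimes\rho\text{-a.s.}$$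
   Context: One-period setting. $X_0,\varepsilon,\varepsilon^0$ are independent real random variables on a probability space with probability $\mathbb{P}$; $\varepsilon,\varepsilon^0$ are centered with unit variance; $\mu_0$ is the law of $X_0$ and $\rho$ the law of $\varepsilon^0$. $\widehat X_0$ is an independent copy of $X_0$ and $\widehat{\mathbb{E}}^{\mu_0}$ integrates over the copy only: $\widehat{\mathbb{E}}^{\mu_0}[\psi(X_0,\widehat X_0,\varepsilon^0)]=\int_{\mathbb{R}}\psi(X_0,\widehat x_0,\varepsilon^0)\,\mu_0(\mathrm{d}\widehat x_0)$. The functions $b,\sigma,\sigma^0:\mathbb{R}\to\mathbb{R}$ are bounded measurable, and $\sigma(X_0)\neq0$, $\sigma^0(X_0)\neq0$ $\mathbb{P}$-a.s. Solutions of $(\ast)$ are understood in $\mathbb{L}^2(\mu_0\otimes\rho)$, with equality $\mu_0\otimes\rho$-a.s. A random environment is a pair $(F^\mu,\pi)$ with $F^\mu=F^\mu(x_0,e)$ and a cross-holding strategy $\pi:\mathbb{R}^2\to\mathbb{R}$ (measurable). Given a random environment and a cross-holding strategy $\beta:\mathbb{R}^2\to\mathbb{R}$ (measurable), $X_1^{\mu,\pi,\beta}:=X_0+\Delta X^{\mu,\pi,\beta}$, where $\Delta X=\Delta X^{\mu,\pi,\beta}$ is given by $$\big(1+\widehat{\mathbb{E}}^{\mu_0}[\pi(\widehat X_0,X_0)]\big)\Delta X=b(X_0)+\sigma(X_0)\varepsilon+\sigma^0(X_0)\varepsilon^0+\widehat{\mathbb{E}}^{\mu_0}\big[\beta(X_0,\widehat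 X_0)F^\mu(\widehat X_0,\varepsilon^0)\big].$$ $\mathcal{A}_2(F^\mu,\pi)$ is the set of all cross-holding strategies $\beta$ such that $X_1^{\mu,\pi,\beta}$ is square integrable. Mean-variance criterion: $\mathbb{MV}_q[\cdot\mid X_0]:=\mathbb{E}[\cdot\mid X_0]-\frac1{2q}\mathbb{V}[\cdot\mid X_0]$, with $\mathbb{V}[\cdot\mid X_0]$ the conditional variance. $(F^\mu,\pi)$ is a mean field equilibrium (for this criterion) if $F^\mu\in\mathbb{L}^1(\mu_0\otimes\rho)$, $\pi\in\mathcal{A}_2(F^\mu,\pi)$ and, $\mathbb{P}$-a.e.: (1) $\mathbb{MV}_q[X_1^{\mu,\pi,\pi}\mid X_0]=\max_{\beta\in\mathcal{A}_2(F^\mu,\pi)}\mathbb{MV}_q[X_1^{\mu,\pi,\beta}\mid X_0]$; (2) $\mathbb{E}[\Delta X^{\mu,\pi,\pi}\mid X_0,\varepsilon^0]=F^\mu(X_0,\varepsilon^0)$.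
   Formalization: The right-hand side of the equivalence additionally requires X_0 to be square integrable and σ(x)/(1+∫π(y,x)μ_0(dy)) to be in L²(μ_0); both follow from the left-hand side, and without them the stated conditions do not make π admissible. *)

theory Defs
  imports "HOL-Probability.Probability"
begin

text \<open>
  Functions of two variables (strategies \<open>\<pi>(x, y)\<close>, environments \<open>F(x, e)\<close>) are functions on
  \<open>real \<times> real\<close>. The parameters \<open>X0 eps eps0\<close> are random variables on \<open>M\<close>; the law of \<open>X0\<close> is
  \<open>distr M borel X0\<close> and the law of \<open>eps0\<close> is \<open>distr M borel eps0\<close>. The expectation over the
  independent copy of \<open>X0\<close> is the integral against the law of \<open>X0\<close>.
\<close>

definition L2 :: "'a measure \<Rightarrow> ('a \<Rightarrow> real) \<Rightarrow> bool" where
  "L2 N f \<longleftrightarrow> f \<in> borel_measurable N \<and> integrable N (\<lambda>x. (f x)\<^sup>2)"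

definition cross_holding_strategy :: "(real \<times> real \<Rightarrow> real) \<Rightarrow> bool" where
  "cross_holding_strategy \<beta> \<longleftrightarrow> \<beta> \<in> borel_measurable (borel \<Otimes>\<^sub>M borel)"

text \<open>
  \<open>is_increment \<dots> F \<pi> \<beta> D\<close>: the random variable \<open>D\<close> is the increment of the state determined by the
  environment \<open>(F, \<pi>)\<close> and the strategy \<open>\<beta>\<close>. The increment is specified by its equation and not by
  a division: where the coefficient \<open>1 + \<integral>\<pi>(y, X0) \<mu>0(dy)\<close> vanishes on a set of positive probability
  no convention \<open>x / 0 = 0\<close> supplies a value. Both integrals in the equation are required to
  converge, since the Bochner integral of a non-integrable function is \<open>0\<close> by convention.
\<close>

definition is_increment ::
  "'a measure \<Rightarrow> ('a \<Rightarrow> real) \<Rightarrow> ('a \<Rightarrow> real) \<Rightarrow> ('a \<Rightarrow> real) \<Rightarrow> (real \<Rightarrow> real) \<Rightarrow> (real \<Rightarrow> real) \<Rightarrow> (real \<Rightarrow> real)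
   \<Rightarrow> (real \<times> real \<Rightarrow> real) \<Rightarrow> (real \<times> real \<Rightarrow> real) \<Rightarrow> (real \<times> real \<Rightarrow> real) \<Rightarrow> ('a \<Rightarrow> real) \<Rightarrow> bool" where
  "is_increment M X0 eps eps0 b \<sigma> \<sigma>0 F \<pi> \<beta> D \<longleftrightarrow>
     D \<in> borel_measurable M \<and>
     (AE \<omega> in M. integrable (distr M borel X0) (\<lambda>y. \<pi> (y, X0 \<omega>))) \<and>
     (AE \<omega> in M. integrable (distr M borel X0) (\<lambda>y. \<beta> (X0 \<omega>, y) * F (y, eps0 \<omega>))) \<and>
     (AE \<omega> in M.
        (1 + (\<integral>y. \<pi> (y, X0 \<omega>) \<partial>distr M borel X0)) * D \<omega> =
        b (X0 \<omega>) + \<sigma> (X0 \<omega>) * eps \<omega> + \<sigma>0 (X0 \<omega>) * eps0 \<omega>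
        + (\<integral>y. \<beta> (X0 \<omega>, y) * F (y, eps0 \<omega>) \<partial>distr M borel X0))"

text \<open>
  Admissibility means unconditional square integrability of \<open>X0 + D\<close>. If \<open>F\<close> is square integrable
  and \<open>\<pi>\<close> itself is admissible with \<open>E[D | X0, eps0] = F(X0, eps0)\<close>, this forces both \<open>X0\<close> and
  \<open>\<sigma>(X0) / (1 + \<integral>\<pi>(y, X0) \<mu>0(dy))\<close> to be square integrable; neither follows from
  \<open>\<pi> \<in> L2\<close> and boundedness of the coefficients, because the denominator need not be bounded away
  from \<open>0\<close>. This is why the two conditions occur in a characterization of equilibria.
\<close>

definition admissible ::
  "'a measure \<Rightarrow> ('a \<Rightarrow> real) \<Rightarrow> ('a \<Rightarrow> real) \<Rightarrow> ('a \<Rightarrow> real) \<Rightarrow> (real \<Rightarrow> real) \<Rightarrow> (real \<Rightarrow> real) \<Rightarrow> (real \<Rightarrow> real)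
   \<Rightarrow> (real \<times> real \<Rightarrow> real) \<Rightarrow> (real \<times> real \<Rightarrow> real) \<Rightarrow> (real \<times> real \<Rightarrow> real) set" where
  "admissible M X0 eps eps0 b \<sigma> \<sigma>0 F \<pi> =
     {\<beta>. cross_holding_strategy \<beta> \<and>
          (\<exists>D. is_increment M X0 eps eps0 b \<sigma> \<sigma>0 F \<pi> \<beta> D \<and> L2 M (\<lambda>\<omega>. X0 \<omega> + D \<omega>))}"

definition sigma_gen :: "'a measure \<Rightarrow> ('a \<Rightarrow> 'b::topological_space) \<Rightarrow> 'a measure" where
  "sigma_gen M Z = vimage_algebra (space M) Z borel"

definition cond_variance :: "'a measure \<Rightarrow> 'a measure \<Rightarrow> ('a \<Rightarrow> real) \<Rightarrow> 'a \<Rightarrow> real" where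
  "cond_variance M G Y = real_cond_exp M G (\<lambda>\<omega>. (Y \<omega> - real_cond_exp M G Y \<omega>)\<^sup>2)"

definition mean_variance :: "'a measure \<Rightarrow> ('a \<Rightarrow> real) \<Rightarrow> real \<Rightarrow> ('a \<Rightarrow> real) \<Rightarrow> 'a \<Rightarrow> real" where
  "mean_variance M X0 q Y \<omega> =
     real_cond_exp M (sigma_gen M X0) Y \<omega> - 1 / (2 * q) * cond_variance M (sigma_gen M X0) Y \<omega>"

text \<open>
  If some strategy is admissible and \<open>\<sigma>(X0) \<noteq> 0\<close> almost surely, increments are almost surely unique, so the quantifiers over \<open>D\<close> and \<open>D'\<close> below only range over
  versions. Conditional expectations are defined up to null sets, so the maximum over the
  (uncountable) admissible set is understood as an attained essential supremum: the exceptional null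
  set may depend on \<open>\<beta>\<close>, and the maximum is attained since \<open>\<pi>\<close> is itself admissible.
\<close>

definition mean_field_equilibrium ::
  "'a measure \<Rightarrow> ('a \<Rightarrow> real) \<Rightarrow> ('a \<Rightarrow> real) \<Rightarrow> ('a \<Rightarrow> real) \<Rightarrow> (real \<Rightarrow> real) \<Rightarrow> (real \<Rightarrow> real) \<Rightarrow> (real \<Rightarrow> real)
   \<Rightarrow> real \<Rightarrow> (real \<times> real \<Rightarrow> real) \<Rightarrow> (real \<times> real \<Rightarrow> real) \<Rightarrow> bool" where
  "mean_field_equilibrium M X0 eps eps0 b \<sigma> \<sigma>0 q F \<pi> \<longleftrightarrow>
     integrable (distr M borel X0 \<Otimes>\<^sub>M distr M borel eps0) F \<and>
     \<pi> \<in> admissible M X0 eps eps0 b \<sigma> \<sigma>0 F \<pi> \<and>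
     (\<forall>D. is_increment M X0 eps eps0 b \<sigma> \<sigma>0 F \<pi> \<pi> D \<longrightarrow>
        (\<forall>\<beta> \<in> admissible M X0 eps eps0 b \<sigma> \<sigma>0 F \<pi>.
           \<forall>D'. is_increment M X0 eps eps0 b \<sigma> \<sigma>0 F \<pi> \<beta> D' \<longrightarrow>
             (AE \<omega> in M. mean_variance M X0 q (\<lambda>\<omega>. X0 \<omega> + D' \<omega>) \<omega>
                          \<le> mean_variance M X0 q (\<lambda>\<omega>. X0 \<omega> + D \<omega>) \<omega>)) \<and>
        (AE \<omega> in M. real_cond_exp M (sigma_gen M (\<lambda>\<omega>. (X0 \<omega>, eps0 \<omega>))) D \<omega>
                     = F (X0 \<omega>, eps0 \<omega>)))"

text \<open>The Fredholm equation, with \<open>\<mu>0\<close> the law of \<open>X0\<close> and \<open>\<rho>\<close> the law of \<open>eps0\<close>.\<close>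

definition fredholm_solution ::
  "real measure \<Rightarrow> real measure \<Rightarrow> (real \<Rightarrow> real) \<Rightarrow> (real \<Rightarrow> real) \<Rightarrow> (real \<times> real \<Rightarrow> real)
   \<Rightarrow> (real \<times> real \<Rightarrow> real) \<Rightarrow> bool" where
  "fredholm_solution \<mu>0 \<rho> b \<sigma>0 \<pi> F \<longleftrightarrow>
     L2 (\<mu>0 \<Otimes>\<^sub>M \<rho>) F \<and>
     (AE (x, e) in \<mu>0 \<Otimes>\<^sub>M \<rho>.
        (1 + (\<integral>y. \<pi> (y, x) \<partial>\<mu>0)) * F (x, e) =
        b x + \<sigma>0 x * e + (\<integral>y. \<pi> (x, y) * F (y, e) \<partial>\<mu>0))"

definition fredholm_uniqueness ::
  "real measure \<Rightarrow> real measure \<Rightarrow> (real \<Rightarrow> real) \<Rightarrow> (real \<Rightarrow> real) \<Rightarrow> (real \<times> real \<Rightarrow> real) \<Rightarrow> bool" where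
  "fredholm_uniqueness \<mu>0 \<rho> b \<sigma>0 \<pi> \<longleftrightarrow>
     (\<forall>F G. fredholm_solution \<mu>0 \<rho> b \<sigma>0 \<pi> F \<longrightarrow> fredholm_solution \<mu>0 \<rho> b \<sigma>0 \<pi> G \<longrightarrow>
        (AE z in \<mu>0 \<Otimes>\<^sub>M \<rho>. F z = G z))"

definition fredholm_unique_solution ::
  "real measure \<Rightarrow> real measure \<Rightarrow> (real \<Rightarrow> real) \<Rightarrow> (real \<Rightarrow> real) \<Rightarrow> (real \<times> real \<Rightarrow> real) \<Rightarrow> bool" where
  "fredholm_unique_solution \<mu>0 \<rho> b \<sigma>0 \<pi> \<longleftrightarrow>
     (\<exists>F. fredholm_solution \<mu>0 \<rho> b \<sigma>0 \<pi> F) \<and> fredholm_uniqueness \<mu>0 \<rho> b \<sigma>0 \<pi>"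

end

theory Submission
  imports Defs
begin

text \<open>
  Write \<open>\<mu>\<close>, \<open>\<rho>\<close>, \<open>\<nu>\<close> for the laws of \<open>X0\<close>, \<open>eps0\<close>, \<open>eps\<close>, let \<open>held x = 1 + \<integral>\<pi>(y, x) \<mu>(dy)\<close> and
  \<open>holdings x = \<integral>\<pi>(x, y) \<mu>(dy)\<close>, and put \<open>s = \<sigma> / held\<close>.

  Since \<open>\<sigma>(X0) eps\<close> is not a function of the two other variables, the existence of an increment forces
  \<open>held \<noteq> 0\<close> almost everywhere. Every increment then splits into a function of \<open>(X0, eps0)\<close>, which is
  the only part that depends on the strategy, and the idiosyncratic part \<open>s(X0) eps\<close>. Conditioning on
  \<open>X0\<close>, or on \<open>(X0, eps0)\<close>, amounts to integrating out the independent noise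
  (\<open>real_cond_exp_freezing\<close>), so that the mean-variance criterion is an explicit integral
  (\<open>mean_variance_affine_noise\<close>).

  \<^emph>\<open>Necessity.\<close> The consistency condition says that \<open>F\<close> is the common part of the increment, which is
  the Fredholm equation. For optimality, the strategies \<open>\<pi>(x, y) + t held(x) \<phi>(y)\<close> with bounded \<open>\<phi>\<close> are
  admissible and add \<open>t \<Phi>(eps0)\<close> to the increment, where \<open>\<Phi>(e) = \<integral>\<phi>(y) F(y, e) \<mu>(dy)\<close>. Differentiating
  the criterion at \<open>t = 0\<close> gives, for almost every \<open>x\<close>,
  \<open>q \<integral>\<Phi> d\<rho> = Cov_\<rho>(F(x, \<cdot>), \<Phi>)\<close> (\<open>first_order_condition\<close>). The left-hand side does not depend on \<open>x\<close>.
  If \<open>\<integral>\<phi> d\<mu> = 0\<close>, multiplying by \<open>\<phi>(x)\<close> and integrating yields \<open>0 = Var_\<rho>(\<Phi>)\<close>; hence \<open>\<Phi>\<close> is constant,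
  the covariance vanishes, and so does \<open>\<Phi>\<close>. As \<open>\<phi>\<close> is an arbitrary centered function, \<open>F(x, e) = g(e)\<close>
  does not depend on \<open>x\<close> (\<open>eq_average_if_first_order_condition\<close>). The Fredholm equation becomes
  \<open>(held - holdings)(x) g(e) = b(x) + \<sigma>0(x) e\<close>, so \<open>g(e) = \<alpha> + \<gamma> e\<close> with \<open>\<gamma> \<noteq> 0\<close>, and \<open>b\<close>, \<open>\<sigma>0\<close> are the
  multiples \<open>\<alpha>\<close>, \<open>\<gamma>\<close> of \<open>held - holdings\<close>. That function has integral \<open>1\<close> by Fubini, whence \<open>\<alpha> = E[b(X0)]\<close>;
  and the first-order condition with \<open>\<phi> = 1\<close> reads \<open>q \<alpha> = \<gamma>\<^sup>2\<close>, which gives \<open>\<alpha> > 0\<close> and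
  \<open>\<lambda> = \<gamma> / \<alpha> = \<plusminus>sqrt (q / \<alpha>)\<close>. The two square-integrability conditions hold because \<open>X0 + s(X0) eps\<close> is
  square integrable and its second moment given \<open>X0 = x\<close> is \<open>x\<^sup>2 + s(x)\<^sup>2\<close>.

  \<^emph>\<open>Sufficiency.\<close> In the environment \<open>F(x, e) = m (1 + \<lambda> e)\<close> a strategy \<open>\<beta>\<close> produces the increment
  \<open>(1 + \<lambda> eps0) k(X0) + s(X0) eps\<close> with \<open>k(x) = (b(x) + m \<integral>\<beta>(x, y) \<mu>(dy)) / held(x)\<close>. As \<open>\<lambda>\<^sup>2 = q / m\<close>, its
  criterion is \<open>X0 + k - k\<^sup>2 / (2m) - s\<^sup>2 / (2q)\<close>, largest for \<open>k = m\<close>; and \<open>k = m\<close> for \<open>\<beta> = \<pi>\<close> is exactly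
  the balance condition on \<open>\<pi>\<close>.
\<close>

section \<open>Square-integrable functions on probability spaces\<close>

lemma L2_measurable [measurable_dest]: "L2 N f \<Longrightarrow> f \<in> borel_measurable N"
  by (simp add: L2_def)

lemma L2_times_integrable:
  assumes "L2 N f" "L2 N g"
  shows "integrable N (\<lambda>x. f x * g x)"
proof (rule Bochner_Integration.integrable_bound)
  show "integrable N (\<lambda>x. (f x)\<^sup>2 + (g x)\<^sup>2)"
    using assms by (auto simp: L2_def)
  show "(\<lambda>x. f x * g x) \<in> borel_measurable N"
    using assms by (auto simp: L2_def)
  have "\<bar>u * v\<bar> \<le> u\<^sup>2 + v\<^sup>2" for u v :: real
    using sum_squares_bound[of u v] sum_squares_bound[of u "- v"] sum_squares_ge_zero[of u v]
    by (auto simp: abs_if power2_eq_square)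
  then show "AE x in N. norm (f x * g x) \<le> norm ((f x)\<^sup>2 + (g x)\<^sup>2)"
    by auto
qed

lemma L2_add:
  assumes "L2 N f" "L2 N g"
  shows "L2 N (\<lambda>x. f x + g x)"
proof -
  have "integrable N (\<lambda>x. (f x)\<^sup>2 + 2 * (f x * g x) + (g x)\<^sup>2)"
    using assms L2_times_integrable[OF assms] by (auto simp: L2_def)
  then show ?thesis
    using assms by (auto simp: L2_def power2_sum algebra_simps)
qed

lemma L2_cmult: "L2 N f \<Longrightarrow> L2 N (\<lambda>x. c * f x)"
  by (auto simp: L2_def power_mult_distrib)

lemma L2_diff: "L2 N f \<Longrightarrow> L2 N g \<Longrightarrow> L2 N (\<lambda>x. f x - g x)"
  using L2_add[of N f "\<lambda>x. -1 * g x"] L2_cmult[of N g "-1"] by simp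

lemma L2_AE_cong:
  assumes "L2 N f" "g \<in> borel_measurable N" "AE x in N. f x = g x"
  shows "L2 N g"
  unfolding L2_def
proof
  have "integrable N (\<lambda>x. (f x)\<^sup>2) \<longleftrightarrow> integrable N (\<lambda>x. (g x)\<^sup>2)"
    using assms by (intro integrable_cong_AE) (auto simp: L2_def)
  then show "integrable N (\<lambda>x. (g x)\<^sup>2)"
    using assms by (simp add: L2_def)
qed (fact assms)

lemma L2_bounded_mult:
  fixes \<phi> :: "'a \<Rightarrow> real"
  assumes "L2 N f" "\<phi> \<in> borel_measurable N" "\<And>x. \<bar>\<phi> x\<bar> \<le> K"
  shows "L2 N (\<lambda>x. \<phi> x * f x)"
  unfolding L2_def
proof
  show "(\<lambda>x. \<phi> x * f x) \<in> borel_measurable N"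
    using assms by (auto simp: L2_def)
  show "integrable N (\<lambda>x. (\<phi> x * f x)\<^sup>2)"
  proof (rule Bochner_Integration.integrable_bound)
    show "integrable N (\<lambda>x. K\<^sup>2 * (f x)\<^sup>2)"
      using assms by (auto simp: L2_def)
    show "(\<lambda>x. (\<phi> x * f x)\<^sup>2) \<in> borel_measurable N"
      using assms by (auto simp: L2_def)
    have "(\<phi> x)\<^sup>2 \<le> K\<^sup>2" for x
      using power_mono[OF assms(3)[of x], of 2] by simp
    then show "AE x in N. norm ((\<phi> x * f x)\<^sup>2) \<le> norm (K\<^sup>2 * (f x)\<^sup>2)"
      by (auto simp: power_mult_distrib intro!: mult_right_mono)
  qed
qed

lemma (in finite_measure) L2_const: "L2 M (\<lambda>_. c :: real)"
  by (auto simp: L2_def)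

lemma (in finite_measure) L2_integrable: "L2 M f \<Longrightarrow> integrable M f"
  using L2_times_integrable[OF _ L2_const[of 1], of f] by simp

lemma (in prob_space) L2_integral_square_diff:
  assumes "L2 M f"
  shows "(\<integral>x. (f x - c)\<^sup>2 \<partial>M) = (\<integral>x. (f x)\<^sup>2 \<partial>M) - 2 * c * (\<integral>x. f x \<partial>M) + c\<^sup>2"
proof -
  have "(\<integral>x. (f x - c)\<^sup>2 \<partial>M) = (\<integral>x. (f x)\<^sup>2 - (2 * c) * f x + c\<^sup>2 \<partial>M)"
    by (intro Bochner_Integration.integral_cong) (auto simp: power2_diff)
  also have "\<dots> = (\<integral>x. (f x)\<^sup>2 \<partial>M) - 2 * c * (\<integral>x. f x \<partial>M) + c\<^sup>2"
    using assms L2_integrable[OF assms] by (auto simp: L2_def prob_space)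
  finally show ?thesis .
qed

lemma (in prob_space) L2_square_integral_le:
  assumes "L2 M f"
  shows "(\<integral>x. f x \<partial>M)\<^sup>2 \<le> (\<integral>x. (f x)\<^sup>2 \<partial>M)"
proof -
  have "0 \<le> (\<integral>x. (f x - (\<integral>x. f x \<partial>M))\<^sup>2 \<partial>M)"
    by simp
  then show ?thesis
    unfolding L2_integral_square_diff[OF assms] by (simp add: power2_eq_square)
qed

lemma (in prob_space) L2_square_integral_eq:
  assumes "L2 M f" and eq: "(\<integral>x. (f x)\<^sup>2 \<partial>M) = (\<integral>x. f x \<partial>M)\<^sup>2"
  shows "AE x in M. f x = (\<integral>x. f x \<partial>M)"
proof -
  let ?c = "\<integral>x. f x \<partial>M"
  have "L2 M (\<lambda>x. f x - ?c)"
    using assms(1) L2_const by (rule L2_diff)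
  moreover have "(\<integral>x. (f x - ?c)\<^sup>2 \<partial>M) = 0"
    unfolding L2_integral_square_diff[OF assms(1)] using eq by (simp add: power2_eq_square)
  ultimately have "AE x in M. (f x - ?c)\<^sup>2 = 0"
    by (subst integral_nonneg_eq_0_iff_AE[symmetric]) (auto simp: L2_def)
  then show ?thesis
    by eventually_elim simp
qed

lemma (in pair_prob_space) L2_AE_section_fst:
  assumes "L2 (M1 \<Otimes>\<^sub>M M2) F"
  shows "AE x in M1. L2 M2 (\<lambda>e. F (x, e))"
proof -
  have "AE x in M1. integrable M2 (\<lambda>e. (F (x, e))\<^sup>2)"
    using assms by (intro AE_integrable_fst') (simp add: L2_def)
  with AE_space show ?thesis
    by eventually_elim (use assms in \<open>auto simp: L2_def\<close>)
qed

lemma (in pair_prob_space) L2_AE_section_snd: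
  assumes "L2 (M1 \<Otimes>\<^sub>M M2) F"
  shows "AE e in M2. L2 M1 (\<lambda>x. F (x, e))"
proof -
  have "AE e in M2. integrable M1 (\<lambda>x. (F (x, e))\<^sup>2)"
    using assms by (intro AE_integrable_snd) (simp add: L2_def split_beta')
  with AE_space show ?thesis
    by eventually_elim (use assms in \<open>auto simp: L2_def\<close>)
qed

text \<open>By the Cauchy-Schwarz inequality, the square of the average is at most the average of the squares,
  which Fubini integrates.\<close>

lemma (in pair_prob_space) L2_average:
  assumes F: "L2 (M1 \<Otimes>\<^sub>M M2) F"
    and [measurable]: "\<phi> \<in> borel_measurable M1" and bnd: "\<And>x. \<bar>\<phi> x\<bar> \<le> K"
  shows "L2 M2 (\<lambda>e. \<integral>x. \<phi> x * F (x, e) \<partial>M1)"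
proof -
  note [measurable] = L2_measurable[OF F]
  have H: "L2 (M1 \<Otimes>\<^sub>M M2) (\<lambda>z. \<phi> (fst z) * F z)"
    by (rule L2_bounded_mult[where K = K]) (use F bnd in auto)
  have "integrable M2 (\<lambda>e. \<integral>x. (\<phi> x * F (x, e))\<^sup>2 \<partial>M1)"
    using H by (intro integrable_snd) (auto simp: L2_def split_beta')
  then have "integrable M2 (\<lambda>e. (\<integral>x. \<phi> x * F (x, e) \<partial>M1)\<^sup>2)"
  proof (rule Bochner_Integration.integrable_bound)
    show "AE e in M2. norm ((\<integral>x. \<phi> x * F (x, e) \<partial>M1)\<^sup>2) \<le> norm (\<integral>x. (\<phi> x * F (x, e))\<^sup>2 \<partial>M1)"
      using L2_AE_section_snd[OF H]
    proof eventually_elim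
      case (elim e)
      then show ?case
        using M1.L2_square_integral_le[of "\<lambda>x. \<phi> x * F (x, e)"] by simp
    qed
  qed measurable
  then show ?thesis
    by (simp add: L2_def)
qed

lemma (in pair_prob_space) L2_comp_fst:
  assumes "L2 M1 f"
  shows "L2 (M1 \<Otimes>\<^sub>M M2) (\<lambda>z. f (fst z))"
proof -
  note [measurable] = L2_measurable[OF assms]
  have "integrable (M1 \<Otimes>\<^sub>M M2) (\<lambda>z. (f (fst z))\<^sup>2)"
    using assms by (intro Fubini_integrable) (auto simp: L2_def M2.prob_space)
  then show ?thesis
    by (simp add: L2_def)
qed

lemma (in pair_prob_space) L2_comp_snd:
  assumes "L2 M2 f"
  shows "L2 (M1 \<Otimes>\<^sub>M M2) (\<lambda>z. f (snd z))"
proof -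
  note [measurable] = L2_measurable[OF assms]
  have "integrable (M1 \<Otimes>\<^sub>M M2) (\<lambda>z. (f (snd z))\<^sup>2)"
    using assms by (intro Fubini_integrable) (auto simp: L2_def)
  then show ?thesis
    by (simp add: L2_def)
qed

lemma (in pair_prob_space) L2_prod:
  assumes f: "L2 M1 f" and g: "L2 M2 g"
  shows "L2 (M1 \<Otimes>\<^sub>M M2) (\<lambda>z. f (fst z) * g (snd z))"
proof -
  note [measurable] = L2_measurable[OF f] L2_measurable[OF g]
  have "integrable (M1 \<Otimes>\<^sub>M M2) (\<lambda>z. (f (fst z) * g (snd z))\<^sup>2)"
    using f g by (intro Fubini_integrable) (auto simp: L2_def power_mult_distrib)
  then show ?thesis
    by (simp add: L2_def)
qed

section \<open>Functions on a product that satisfy a first-order condition\<close>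

text \<open>The rectangles form an intersection-stable generator, and the sets on which \<open>W\<close> integrates to zero
  form a Dynkin system.\<close>

lemma (in pair_prob_space) AE_zero_if_zero_on_rectangles:
  fixes W :: "'a \<times> 'b \<Rightarrow> real"
  assumes W: "integrable (M1 \<Otimes>\<^sub>M M2) W"
    and rect: "\<And>S T. S \<in> sets M1 \<Longrightarrow> T \<in> sets M2 \<Longrightarrow> (\<integral>z\<in>S \<times> T. W z \<partial>(M1 \<Otimes>\<^sub>M M2)) = 0"
  shows "AE z in M1 \<Otimes>\<^sub>M M2. W z = 0"
proof (rule density_unique_real[OF W])
  let ?N = "M1 \<Otimes>\<^sub>M M2"
  show "integrable ?N (\<lambda>_. 0 :: real)" by simp
  have sint: "set_integrable ?N A W" if "A \<in> sets ?N" for A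
    using integrable_mult_indicator[OF that W] by (simp add: set_integrable_def)
  fix A assume "A \<in> sets ?N"
  with Int_stable_pair_measure_generator[of M1 M2] pair_measure_closed[of M1 M2]
  have "(\<integral>z\<in>A. W z \<partial>?N) = 0"
    unfolding sets_pair_measure
  proof (induct rule: sigma_sets_induct_disjoint)
    case (basic A)
    then show ?case using rect by auto
  next
    case empty
    then show ?case by (simp add: set_lebesgue_integral_def)
  next
    case (compl A)
    then have A: "A \<in> sets ?N" by (simp add: sets_pair_measure)
    have sp: "space ?N = A \<union> (space ?N - A)"
      using sets.sets_into_space[OF A] by auto
    have "0 = (\<integral>z\<in>space ?N. W z \<partial>?N)"
      using rect[of "space M1" "space M2"] by (simp add: space_pair_measure)
    also have "\<dots> = (\<integral>z\<in>A. W z \<partial>?N) + (\<integral>z\<in>space ?N - A. W z \<partial>?N)"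
      by (subst sp, subst set_integral_Un) (use A sint in auto)
    finally show ?case using compl by (simp add: space_pair_measure)
  next
    case (union A)
    then have A: "\<And>i. A i \<in> sets ?N" by (auto simp: sets_pair_measure)
    have "(\<integral>z\<in>(\<Union>i. A i). W z \<partial>?N) = (\<Sum>i. \<integral>z\<in>A i. W z \<partial>?N)"
      using A union(1) sint
      by (intro lebesgue_integral_countable_add) (auto simp: disjoint_family_on_def)
    then show ?case using union(3) by simp
  qed
  then show "(\<integral>z\<in>A. W z \<partial>?N) = (\<integral>z\<in>A. 0 \<partial>?N)"
    by simp
qed

text \<open>The hypothesis \<open>foc\<close> equates a number to the covariance of \<open>F(x, \<cdot>)\<close> with \<open>\<Phi>\<close>. Averaging that covariance
  over \<open>x\<close> with weight \<open>\<phi>\<close> replaces \<open>F(x, \<cdot>)\<close> by \<open>\<Phi>\<close>, by bilinearity, and so gives the variance of \<open>\<Phi>\<close>;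
  averaging the number gives zero. Once \<open>\<Phi>\<close> is known to be constant, \<open>foc\<close> itself says that the
  constant is zero.\<close>

lemma (in pair_prob_space) centered_average_eq_zero:
  fixes F :: "'a \<times> 'b \<Rightarrow> real" and q K :: real
  assumes F: "L2 (M1 \<Otimes>\<^sub>M M2) F" and "q \<noteq> 0"
    and \<phi> [measurable]: "\<phi> \<in> borel_measurable M1" and bnd: "\<And>x. \<bar>\<phi> x\<bar> \<le> K"
    and \<Phi>: "\<Phi> = (\<lambda>e. \<integral>y. \<phi> y * F (y, e) \<partial>M1)"
    and cent: "(\<integral>x. \<phi> x \<partial>M1) = 0"
    and foc: "AE x in M1. q * (\<integral>e. \<Phi> e \<partial>M2) =
      (\<integral>e. F (x, e) * \<Phi> e \<partial>M2) - (\<integral>e. F (x, e) \<partial>M2) * (\<integral>e. \<Phi> e \<partial>M2)"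
  shows "AE e in M2. \<Phi> e = 0"
proof -
  let ?N = "M1 \<Otimes>\<^sub>M M2"
  define c where "c = (\<integral>e. \<Phi> e \<partial>M2)"
  define u where "u x = (\<integral>e. F (x, e) * \<Phi> e \<partial>M2)" for x
  define v where "v x = (\<integral>e. F (x, e) \<partial>M2)" for x
  note [measurable] = L2_measurable[OF F]
  have L2\<Phi>: "L2 M2 \<Phi>"
    unfolding \<Phi> by (rule L2_average[OF F \<phi> bnd])
  note [measurable] = L2_measurable[OF L2\<Phi>]
  have [measurable]: "u \<in> borel_measurable M1" "v \<in> borel_measurable M1"
    unfolding u_def v_def by measurable
  have L2\<phi>F: "L2 ?N (\<lambda>z. \<phi> (fst z) * F z)"
    by (rule L2_bounded_mult[where K = K]) (use F bnd in auto)
  have i1: "integrable ?N (\<lambda>(x, e). \<phi> x * F (x, e))"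
    using P.L2_integrable[OF L2\<phi>F] by (simp add: split_beta')
  have i2: "integrable ?N (\<lambda>(x, e). \<phi> x * F (x, e) * \<Phi> e)"
    using L2_times_integrable[OF L2\<phi>F L2_comp_snd[OF L2\<Phi>]] by (simp add: split_beta')
  have v: "integrable M1 (\<lambda>x. \<phi> x * v x)" "(\<integral>x. \<phi> x * v x \<partial>M1) = c"
    using integrable_fst[OF i1] integral_fst[OF i1] integral_snd[OF i1]
    by (auto simp: v_def c_def \<Phi>)
  have sq: "(\<integral>x. \<phi> x * F (x, e) * \<Phi> e \<partial>M1) = (\<Phi> e)\<^sup>2" for e
    by (simp add: \<Phi> power2_eq_square)
  have u: "integrable M1 (\<lambda>x. \<phi> x * u x)" "(\<integral>x. \<phi> x * u x \<partial>M1) = (\<integral>e. (\<Phi> e)\<^sup>2 \<partial>M2)"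
    using integrable_fst[OF i2] integral_fst[OF i2] integral_snd[OF i2]
    unfolding sq by (auto simp: u_def mult.assoc)
  \<comment> \<open>The left-hand side of the condition does not depend on \<open>x\<close>, so it is annihilated by \<open>\<phi>\<close>.\<close>
  have "0 = (\<integral>x. \<phi> x * (q * c) \<partial>M1)"
    using cent by simp
  also have "\<dots> = (\<integral>x. \<phi> x * u x - c * (\<phi> x * v x) \<partial>M1)"
  proof (rule integral_cong_AE)
    have "AE x in M1. q * c = u x - v x * c"
      using foc by (simp add: u_def v_def c_def)
    then show "AE x in M1. \<phi> x * (q * c) = \<phi> x * u x - c * (\<phi> x * v x)"
      by eventually_elim algebra
  qed measurable
  also have "\<dots> = (\<integral>e. (\<Phi> e)\<^sup>2 \<partial>M2) - c\<^sup>2"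
    using u v by (simp add: power2_eq_square)
  finally have ae: "AE e in M2. \<Phi> e = c"
    using M2.L2_square_integral_eq[OF L2\<Phi>] by (simp add: c_def)
  have "AE x in M1. q * c = 0"
    using foc AE_space
  proof eventually_elim
    case (elim x)
    have [measurable]: "x \<in> space M1 \<Longrightarrow> (\<lambda>e. F (x, e)) \<in> borel_measurable M2" by simp
    have "(\<integral>e. F (x, e) * \<Phi> e \<partial>M2) = (\<integral>e. F (x, e) * c \<partial>M2)" if "x \<in> space M1"
      by (intro integral_cong_AE) (use that ae in \<open>auto elim!: eventually_mono\<close>)
    then show ?case using elim M1.AE_False by (auto simp: c_def)
  qed
  then have "c = 0"
    using \<open>q \<noteq> 0\<close> by simp
  with ae show ?thesis by simp
qed

text \<open>Testing against centered indicators \<open>1\<^sub>S - M1(S)\<close> shows that the integral of \<open>F\<close> over a rectangle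
  does not change when \<open>F\<close> is replaced by its average over the first variable.\<close>

lemma (in pair_prob_space) eq_average_if_first_order_condition:
  fixes F :: "'a \<times> 'b \<Rightarrow> real" and q :: real
  assumes F: "L2 (M1 \<Otimes>\<^sub>M M2) F" and q: "q \<noteq> 0"
    and foc: "\<And>\<phi> K. \<phi> \<in> borel_measurable M1 \<Longrightarrow> (\<And>x. \<bar>\<phi> x\<bar> \<le> K) \<Longrightarrow>
      AE x in M1. q * (\<integral>e. (\<integral>y. \<phi> y * F (y, e) \<partial>M1) \<partial>M2) =
      (\<integral>e. F (x, e) * (\<integral>y. \<phi> y * F (y, e) \<partial>M1) \<partial>M2)
      - (\<integral>e. F (x, e) \<partial>M2) * (\<integral>e. (\<integral>y. \<phi> y * F (y, e) \<partial>M1) \<partial>M2)"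
  shows "AE z in M1 \<Otimes>\<^sub>M M2. F z = (\<integral>y. F (y, snd z) \<partial>M1)"
proof -
  let ?N = "M1 \<Otimes>\<^sub>M M2"
  define g where "g e = (\<integral>y. F (y, e) \<partial>M1)" for e
  have "L2 M2 g"
    using L2_average[OF F, of "\<lambda>_. 1" 1] by (simp add: g_def[abs_def])
  then have L2g: "L2 ?N (\<lambda>z. g (snd z))"
    by (rule L2_comp_snd)
  note [measurable] = L2_measurable[OF F] L2_measurable[OF \<open>L2 M2 g\<close>]
  have L2W: "L2 ?N (\<lambda>z. F z - g (snd z))"
    using F L2g by (rule L2_diff)
  have "AE z in ?N. F z - g (snd z) = 0"
  proof (rule AE_zero_if_zero_on_rectangles)
    show "integrable ?N (\<lambda>z. F z - g (snd z))"
      using L2W by (rule P.L2_integrable)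
    fix S T assume [measurable]: "S \<in> sets M1" "T \<in> sets M2"
    define \<phi> where "\<phi> x = indicator S x - measure M1 S" for x
    have [measurable]: "\<phi> \<in> borel_measurable M1"
      unfolding \<phi>_def by measurable
    have bnd: "\<bar>\<phi> x\<bar> \<le> 1" for x
      by (auto simp: \<phi>_def indicator_def)
    have "integrable M1 (indicator S :: 'a \<Rightarrow> real)"
      by (simp add: integrable_indicator_iff M1.emeasure_eq_measure)
    note ind = this
    then have "(\<integral>x. \<phi> x \<partial>M1) = 0"
      by (simp add: \<phi>_def M1.prob_space)
    then have "AE e in M2. (\<integral>y. \<phi> y * F (y, e) \<partial>M1) = 0"
      by (intro centered_average_eq_zero[OF F q _ bnd refl _ foc[OF _ bnd]]) simp_all
    with L2_AE_section_snd[OF F] AE_space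
    have ae: "AE e in M2. (\<integral>x. indicator S x * (F (x, e) - g e) \<partial>M1) = 0"
    proof eventually_elim
      case (elim e)
      have 1: "integrable M1 (\<lambda>x. F (x, e))"
        using elim by (intro M1.L2_integrable)
      then have 2: "integrable M1 (\<lambda>x. indicator S x * F (x, e))"
        using integrable_mult_indicator[of S M1 "\<lambda>x. F (x, e)"] by simp
      have "(\<integral>y. \<phi> y * F (y, e) \<partial>M1) = (\<integral>y. indicator S y * F (y, e) - measure M1 S * F (y, e) \<partial>M1)"
        by (simp add: \<phi>_def algebra_simps)
      also have "\<dots> = (\<integral>y. indicator S y * F (y, e) \<partial>M1) - measure M1 S * g e"
        using 1 2 by (simp add: g_def)
      also have "\<dots> = (\<integral>x. indicator S x * (F (x, e) - g e) \<partial>M1)"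
        using 2 ind by (simp add: right_diff_distrib)
      finally show ?case using elim by simp
    qed
    have L2ind: "L2 ?N (\<lambda>z. indicator (S \<times> T) z * (F z - g (snd z)))"
      by (rule L2_bounded_mult[OF L2W, where K = 1]) (auto simp: indicator_def)
    have "integrable ?N (\<lambda>(x, e). indicator (S \<times> T) (x, e) * (F (x, e) - g e))"
      using P.L2_integrable[OF L2ind] by (simp add: split_beta')
    from integral_snd[OF this]
    have "(\<integral>z\<in>S \<times> T. F z - g (snd z) \<partial>?N)
      = (\<integral>e. (\<integral>x. indicator (S \<times> T) (x, e) * (F (x, e) - g e) \<partial>M1) \<partial>M2)"
      by (simp add: set_lebesgue_integral_def split_beta')
    also have "\<dots> = (\<integral>e. indicator T e * (\<integral>x. indicator S x * (F (x, e) - g e) \<partial>M1) \<partial>M2)"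
      by (simp add: indicator_times mult.commute mult.left_commute
          flip: integral_mult_right_zero)
    also have "\<dots> = (\<integral>e. 0 \<partial>M2)"
      by (intro integral_cong_AE) (use ae in \<open>auto elim!: eventually_mono\<close>)
    finally show "(\<integral>z\<in>S \<times> T. F z - g (snd z) \<partial>?N) = 0" by simp
  qed
  then show ?thesis
    by (simp add: g_def)
qed

section \<open>Standardized noise and conditioning on an independent variable\<close>

lemma (in prob_space) standardized_affine_moments:
  fixes n :: "'a \<Rightarrow> real"
  assumes n: "L2 M n" "(\<integral>y. n y \<partial>M) = 0" "(\<integral>y. (n y)\<^sup>2 \<partial>M) = 1"
  shows "(\<integral>y. u + v * n y \<partial>M) = u"
    and "(\<integral>y. (u + v * n y)\<^sup>2 \<partial>M) = u\<^sup>2 + v\<^sup>2"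
proof -
  note int_n = L2_integrable[OF n(1)]
  show "(\<integral>y. u + v * n y \<partial>M) = u"
    using int_n n(2) by (simp add: prob_space)
  have "(\<integral>y. (u + v * n y)\<^sup>2 \<partial>M) = (\<integral>y. u\<^sup>2 + (2 * u * v) * n y + v\<^sup>2 * (n y)\<^sup>2 \<partial>M)"
    by (simp add: power2_sum power_mult_distrib algebra_simps)
  also have "\<dots> = u\<^sup>2 + v\<^sup>2"
    using int_n n by (simp add: L2_def prob_space)
  finally show "(\<integral>y. (u + v * n y)\<^sup>2 \<partial>M) = u\<^sup>2 + v\<^sup>2" .
qed

text \<open>A standardized variable satisfies no nontrivial affine relation \<open>u + v n = 0\<close>: the second moment of the
  left-hand side is \<open>u\<^sup>2 + v\<^sup>2\<close>. This is what excludes constant noise below.\<close>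

lemma (in prob_space) standardized_AE_affine_zero:
  fixes n :: "'a \<Rightarrow> real"
  assumes n: "L2 M n" "(\<integral>y. n y \<partial>M) = 0" "(\<integral>y. (n y)\<^sup>2 \<partial>M) = 1"
    and zero: "AE y in M. u + v * n y = 0"
  shows "u = 0 \<and> v = 0"
proof -
  note [measurable] = L2_measurable[OF n(1)]
  have "(\<integral>y. (u + v * n y)\<^sup>2 \<partial>M) = (\<integral>y. 0 \<partial>M)"
    by (intro integral_cong_AE) (use zero in \<open>auto elim!: eventually_mono\<close>)
  then have "u\<^sup>2 + v\<^sup>2 = 0"
    by (simp add: standardized_affine_moments(2)[OF n])
  then show ?thesis
    by (simp add: sum_power2_eq_zero_iff)
qed

text \<open>By Fubini, the moments may be taken with the intercept \<open>a\<close> frozen; the cross term then vanishes because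
  \<open>n\<close> is centered.\<close>

lemma (in pair_prob_space) affine_noise_moments:
  fixes a :: "'a \<Rightarrow> real" and n :: "'b \<Rightarrow> real"
  assumes a: "L2 M1 a" and n: "L2 M2 n" "(\<integral>y. n y \<partial>M2) = 0" "(\<integral>y. (n y)\<^sup>2 \<partial>M2) = 1"
  shows "L2 (M1 \<Otimes>\<^sub>M M2) (\<lambda>z. a (fst z) + c * n (snd z))"
    and "(\<integral>z. a (fst z) + c * n (snd z) \<partial>(M1 \<Otimes>\<^sub>M M2)) = (\<integral>e. a e \<partial>M1)"
    and "(\<integral>z. (a (fst z) + c * n (snd z))\<^sup>2 \<partial>(M1 \<Otimes>\<^sub>M M2)) = (\<integral>e. (a e)\<^sup>2 \<partial>M1) + c\<^sup>2"
proof -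
  let ?N = "M1 \<Otimes>\<^sub>M M2"
  show L2: "L2 ?N (\<lambda>z. a (fst z) + c * n (snd z))"
    by (intro L2_add L2_cmult L2_comp_fst L2_comp_snd a n)
  have "(\<integral>z. a (fst z) + c * n (snd z) \<partial>?N) = (\<integral>e. \<integral>y. a e + c * n y \<partial>M2 \<partial>M1)"
    using integral_fst'[OF P.L2_integrable[OF L2]] by simp
  also have "\<dots> = (\<integral>e. a e \<partial>M1)"
    by (simp add: M2.standardized_affine_moments(1)[OF n])
  finally show "(\<integral>z. a (fst z) + c * n (snd z) \<partial>?N) = (\<integral>e. a e \<partial>M1)" .
  have "(\<integral>z. (a (fst z) + c * n (snd z))\<^sup>2 \<partial>?N) = (\<integral>e. \<integral>y. (a e + c * n y)\<^sup>2 \<partial>M2 \<partial>M1)"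
    using integral_fst'[of "\<lambda>z. (a (fst z) + c * n (snd z))\<^sup>2"] L2 by (simp add: L2_def)
  also have "\<dots> = (\<integral>e. (a e)\<^sup>2 + c\<^sup>2 \<partial>M1)"
    by (simp add: M2.standardized_affine_moments(2)[OF n])
  also have "\<dots> = (\<integral>e. (a e)\<^sup>2 \<partial>M1) + c\<^sup>2"
    using a by (simp add: L2_def M1.prob_space)
  finally show "(\<integral>z. (a (fst z) + c * n (snd z))\<^sup>2 \<partial>?N) = (\<integral>e. (a e)\<^sup>2 \<partial>M1) + c\<^sup>2" .
qed

text \<open>Independence is used below in the form that the joint law factorizes, for variables with values in
  different spaces such as \<open>X0\<close> and \<open>(eps0, eps)\<close>. The factorization passes to images because the product
  of image measures is the image of the product.\<close>

lemma (in prob_space) joint_law_of_indep: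
  assumes ind: "indep_var N A N' B" and f: "f \<in> measurable N S" and g: "g \<in> measurable N' T"
  shows "distr M (S \<Otimes>\<^sub>M T) (\<lambda>\<omega>. (f (A \<omega>), g (B \<omega>)))
    = distr M S (\<lambda>\<omega>. f (A \<omega>)) \<Otimes>\<^sub>M distr M T (\<lambda>\<omega>. g (B \<omega>))"
proof -
  have A: "A \<in> measurable M N" and B: "B \<in> measurable M N'"
    and joint: "distr M N A \<Otimes>\<^sub>M distr M N' B = distr M (N \<Otimes>\<^sub>M N') (\<lambda>\<omega>. (A \<omega>, B \<omega>))"
    using ind unfolding indep_var_distribution_eq by auto
  note [measurable] = A B f g
  interpret B: prob_space "distr (distr M N' B) T g"
    by (intro prob_space.prob_space_distr prob_space_distr) measurable
  have "distr M (S \<Otimes>\<^sub>M T) (\<lambda>\<omega>. (f (A \<omega>), g (B \<omega>)))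
    = distr (distr M (N \<Otimes>\<^sub>M N') (\<lambda>\<omega>. (A \<omega>, B \<omega>))) (S \<Otimes>\<^sub>M T) (\<lambda>(x, y). (f x, g y))"
    by (subst distr_distr) (auto simp: comp_def)
  also have "\<dots> = distr (distr M N A) S f \<Otimes>\<^sub>M distr (distr M N' B) T g"
    unfolding joint[symmetric]
    by (subst pair_measure_distr) (auto intro: B.sigma_finite_measure_axioms)
  also have "\<dots> = distr M S (\<lambda>\<omega>. f (A \<omega>)) \<Otimes>\<^sub>M distr M T (\<lambda>\<omega>. g (B \<omega>))"
    by (simp add: distr_distr comp_def)
  finally show ?thesis .
qed

text \<open>Conditional expectation given \<open>Z\<close> freezes \<open>Z\<close> and integrates out the independent variable \<open>W\<close>: on sets
  \<open>Z \<in> B\<close>, which generate the conditioning, this is Fubini for the joint law.\<close>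

lemma (in prob_space) nn_cond_exp_freezing:
  assumes Z [measurable]: "Z \<in> measurable M N" and W [measurable]: "W \<in> measurable M N'"
    and joint: "distr M (N \<Otimes>\<^sub>M N') (\<lambda>\<omega>. (Z \<omega>, W \<omega>)) = distr M N Z \<Otimes>\<^sub>M distr M N' W"
    and f [measurable]: "f \<in> borel_measurable (N \<Otimes>\<^sub>M N')"
  shows "AE \<omega> in M. (\<integral>\<^sup>+w. f (Z \<omega>, w) \<partial>distr M N' W) =
    nn_cond_exp M (vimage_algebra (space M) Z N) (\<lambda>\<omega>. f (Z \<omega>, W \<omega>)) \<omega>"
proof -
  let ?F = "vimage_algebra (space M) Z N"
  interpret W: prob_space "distr M N' W" by (rule prob_space_distr) fact
  have sp: "Z \<in> space M \<rightarrow> space N" using Z by (auto simp: measurable_def)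
  have sub: "subalgebra M ?F"
    unfolding subalgebra_def using sets_vimage_algebra2[OF sp] by auto
  interpret finite_measure_subalgebra M ?F
    by unfold_locales (rule sub)
  have ZF [measurable]: "Z \<in> measurable ?F N"
    by (rule measurable_vimage_algebra1) (rule sp)
  define g where "g z = (\<integral>\<^sup>+w. f (z, w) \<partial>distr M N' W)" for z
  have [measurable]: "g \<in> borel_measurable N"
    unfolding g_def by measurable
  have "AE \<omega> in M. g (Z \<omega>) = nn_cond_exp M ?F (\<lambda>\<omega>. f (Z \<omega>, W \<omega>)) \<omega>"
  proof (rule nn_cond_exp_charact)
    fix A assume "A \<in> sets ?F"
    then obtain B where [measurable]: "B \<in> sets N" and A: "A = Z -` B \<inter> space M"
      using sets_vimage_algebra2[OF sp] by auto
    have "(\<integral>\<^sup>+\<omega>\<in>A. f (Z \<omega>, W \<omega>) \<partial>M) = (\<integral>\<^sup>+\<omega>. f (Z \<omega>, W \<omega>) * indicator B (Z \<omega>) \<partial>M)"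
      by (intro nn_integral_cong) (auto simp: A indicator_def)
    also have "\<dots> = (\<integral>\<^sup>+z. f z * indicator B (fst z) \<partial>(distr M N Z \<Otimes>\<^sub>M distr M N' W))"
      unfolding joint[symmetric] by (subst nn_integral_distr) simp_all
    also have "\<dots> = (\<integral>\<^sup>+z. g z * indicator B z \<partial>distr M N Z)"
    proof (subst W.nn_integral_fst[symmetric])
      show "(\<integral>\<^sup>+z. \<integral>\<^sup>+w. f (z, w) * indicator B (fst (z, w)) \<partial>distr M N' W \<partial>distr M N Z)
        = (\<integral>\<^sup>+z. g z * indicator B z \<partial>distr M N Z)"
        by (intro nn_integral_cong) (simp add: g_def nn_integral_multc)
    qed measurable
    also have "\<dots> = (\<integral>\<^sup>+\<omega>. g (Z \<omega>) * indicator B (Z \<omega>) \<partial>M)"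
      by (subst nn_integral_distr) simp_all
    also have "\<dots> = (\<integral>\<^sup>+\<omega>\<in>A. g (Z \<omega>) \<partial>M)"
      by (intro nn_integral_cong) (auto simp: A indicator_def)
    finally show "(\<integral>\<^sup>+\<omega>\<in>A. f (Z \<omega>, W \<omega>) \<partial>M) = (\<integral>\<^sup>+\<omega>\<in>A. g (Z \<omega>) \<partial>M)" .
  qed measurable
  then show ?thesis
    by (simp add: g_def)
qed

text \<open>Integrability is a condition on the sections \<open>f(z, \<cdot>)\<close> because the terminal state is conditioned on
  \<open>X0\<close> without any integrability of \<open>X0\<close>. The positive and negative parts are frozen separately.\<close>

lemma (in prob_space) real_cond_exp_freezing:
  fixes f :: "'b \<times> 'c \<Rightarrow> real"
  assumes Z [measurable]: "Z \<in> measurable M N" and W [measurable]: "W \<in> measurable M N'"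
    and joint: "distr M (N \<Otimes>\<^sub>M N') (\<lambda>\<omega>. (Z \<omega>, W \<omega>)) = distr M N Z \<Otimes>\<^sub>M distr M N' W"
    and f [measurable]: "f \<in> borel_measurable (N \<Otimes>\<^sub>M N')"
    and int: "AE z in distr M N Z. integrable (distr M N' W) (\<lambda>w. f (z, w))"
  shows "AE \<omega> in M. real_cond_exp M (vimage_algebra (space M) Z N) (\<lambda>\<omega>. f (Z \<omega>, W \<omega>)) \<omega>
    = (\<integral>w. f (Z \<omega>, w) \<partial>distr M N' W)"
proof -
  have "AE \<omega> in M. integrable (distr M N' W) (\<lambda>w. f (Z \<omega>, w))"
    using AE_distrD[OF Z int] .
  moreover have "AE \<omega> in M. (\<integral>\<^sup>+w. ennreal (f (Z \<omega>, w)) \<partial>distr M N' W) =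
      nn_cond_exp M (vimage_algebra (space M) Z N) (\<lambda>\<omega>. ennreal (f (Z \<omega>, W \<omega>))) \<omega>"
    by (rule nn_cond_exp_freezing[OF Z W joint]) measurable
  moreover have "AE \<omega> in M. (\<integral>\<^sup>+w. ennreal (- f (Z \<omega>, w)) \<partial>distr M N' W) =
      nn_cond_exp M (vimage_algebra (space M) Z N) (\<lambda>\<omega>. ennreal (- f (Z \<omega>, W \<omega>))) \<omega>"
    by (rule nn_cond_exp_freezing[OF Z W joint]) measurable
  ultimately show ?thesis
    by eventually_elim (simp add: real_cond_exp_def real_lebesgue_integral_def)
qed

section \<open>The one-period model\<close>

text \<open>This replaces differentiation at zero: a variational inequality that holds almost surely for each
  perturbation size holds simultaneously only for countably many of them, and the sizes \<open>1 / k\<close> with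
  integer \<open>k\<close> suffice.\<close>

lemma zero_if_int_multiples_bounded:
  fixes a w :: real
  assumes "\<And>k :: int. k \<noteq> 0 \<Longrightarrow> of_int k * a \<le> w"
  shows "a = 0"
proof (rule ccontr)
  assume "a \<noteq> 0"
  then obtain n :: nat where n: "\<bar>w\<bar> < of_nat n * \<bar>a\<bar>"
    using reals_Archimedean3[of "\<bar>a\<bar>"] by auto
  then have "n \<noteq> 0" by (intro notI) simp
  then show False
    using n assms[of "int n"] assms[of "- int n"] by (cases "a > 0") auto
qed

locale one_period = prob_space M for M :: "'a measure" +
  fixes X0 eps eps0 :: "'a \<Rightarrow> real"
    and b \<sigma> \<sigma>0 :: "real \<Rightarrow> real"
    and q :: real
    and \<pi> :: "real \<times> real \<Rightarrow> real"
  assumes indep: "indep_vars (\<lambda>_. borel) (\<lambda>i. [X0, eps, eps0] ! i) {0, 1, 2}"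
    and eps: "integrable M (\<lambda>\<omega>. (eps \<omega>)\<^sup>2)" "(\<integral>\<omega>. eps \<omega> \<partial>M) = 0" "(\<integral>\<omega>. (eps \<omega>)\<^sup>2 \<partial>M) = 1"
    and eps0: "integrable M (\<lambda>\<omega>. (eps0 \<omega>)\<^sup>2)" "(\<integral>\<omega>. eps0 \<omega> \<partial>M) = 0" "(\<integral>\<omega>. (eps0 \<omega>)\<^sup>2 \<partial>M) = 1"
    and b [measurable]: "b \<in> borel_measurable borel"
    and \<sigma> [measurable]: "\<sigma> \<in> borel_measurable borel"
    and \<sigma>0 [measurable]: "\<sigma>0 \<in> borel_measurable borel"
    and nz_\<sigma>: "AE \<omega> in M. \<sigma> (X0 \<omega>) \<noteq> 0"
    and nz_\<sigma>0: "AE \<omega> in M. \<sigma>0 (X0 \<omega>) \<noteq> 0"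
    and q_pos: "q > 0"
    and L2_\<pi>: "L2 (distr M borel X0 \<Otimes>\<^sub>M distr M borel X0) \<pi>"
begin

abbreviation "\<mu> \<equiv> distr M borel X0"
abbreviation "\<rho> \<equiv> distr M borel eps0"
abbreviation "\<nu> \<equiv> distr M borel eps"

lemma measurable_X0 [measurable]: "X0 \<in> borel_measurable M"
  and measurable_eps [measurable]: "eps \<in> borel_measurable M"
  and measurable_eps0 [measurable]: "eps0 \<in> borel_measurable M"
  using indep by (auto simp: indep_vars_def)

sublocale \<mu>: prob_space \<mu> by (rule prob_space_distr) measurable
sublocale \<rho>: prob_space \<rho> by (rule prob_space_distr) measurable
sublocale \<nu>: prob_space \<nu> by (rule prob_space_distr) measurable
sublocale \<mu>\<rho>: pair_prob_space \<mu> \<rho> ..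
sublocale \<mu>\<mu>: pair_prob_space \<mu> \<mu> ..
sublocale \<rho>\<nu>: pair_prob_space \<rho> \<nu> ..
sublocale \<mu>\<nu>: pair_prob_space \<mu> \<nu> ..
sublocale \<mu>_\<rho>\<nu>: pair_prob_space \<mu> "\<rho> \<Otimes>\<^sub>M \<nu>" ..
sublocale \<mu>\<rho>_\<nu>: pair_prob_space "\<mu> \<Otimes>\<^sub>M \<rho>" \<nu> ..

text \<open>The source of all factorizations below: \<open>A\<close> and \<open>B\<close> select disjoint blocks of positions in the list
  \<open>[X0, eps, eps0]\<close>, and \<open>f\<close>, \<open>g\<close> rearrange each block as a tuple.\<close>

lemma joint_law:
  assumes "A \<inter> B = {}" "A \<subseteq> {0, 1, 2}" "B \<subseteq> {0, 1, 2}"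
    and "f \<in> measurable (Pi\<^sub>M A (\<lambda>_. borel)) S" "g \<in> measurable (Pi\<^sub>M B (\<lambda>_. borel)) T"
  shows "distr M (S \<Otimes>\<^sub>M T) (\<lambda>\<omega>. (f (\<lambda>i\<in>A. ([X0, eps, eps0] ! i) \<omega>), g (\<lambda>i\<in>B. ([X0, eps, eps0] ! i) \<omega>)))
    = distr M S (\<lambda>\<omega>. f (\<lambda>i\<in>A. ([X0, eps, eps0] ! i) \<omega>)) \<Otimes>\<^sub>M
      distr M T (\<lambda>\<omega>. g (\<lambda>i\<in>B. ([X0, eps, eps0] ! i) \<omega>))"
  by (rule joint_law_of_indep[OF indep_var_restrict[OF indep]]) (use assms in auto)

lemma law_X0_eps0: "distr M (borel \<Otimes>\<^sub>M borel) (\<lambda>\<omega>. (X0 \<omega>, eps0 \<omega>)) = \<mu> \<Otimes>\<^sub>M \<rho>"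
  using joint_law[of "{0}" "{2}" "\<lambda>f. f 0" borel "\<lambda>f. f 2" borel] by simp

lemma law_X0_eps: "distr M (borel \<Otimes>\<^sub>M borel) (\<lambda>\<omega>. (X0 \<omega>, eps \<omega>)) = \<mu> \<Otimes>\<^sub>M \<nu>"
  using joint_law[of "{0}" "{1}" "\<lambda>f. f 0" borel "\<lambda>f. f 1" borel] by simp

lemma law_noise: "distr M (borel \<Otimes>\<^sub>M borel) (\<lambda>\<omega>. (eps0 \<omega>, eps \<omega>)) = \<rho> \<Otimes>\<^sub>M \<nu>"
  using joint_law[of "{2}" "{1}" "\<lambda>f. f 2" borel "\<lambda>f. f 1" borel] by simp

lemma law_X0_noise:
  "distr M (borel \<Otimes>\<^sub>M (borel \<Otimes>\<^sub>M borel)) (\<lambda>\<omega>. (X0 \<omega>, (eps0 \<omega>, eps \<omega>)))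
    = \<mu> \<Otimes>\<^sub>M distr M (borel \<Otimes>\<^sub>M borel) (\<lambda>\<omega>. (eps0 \<omega>, eps \<omega>))"
  using joint_law[of "{0}" "{1, 2}" "\<lambda>f. f 0" borel "\<lambda>f. (f 2, f 1)" "borel \<Otimes>\<^sub>M borel"] by simp

lemma law_X0_eps0_eps:
  "distr M ((borel \<Otimes>\<^sub>M borel) \<Otimes>\<^sub>M borel) (\<lambda>\<omega>. ((X0 \<omega>, eps0 \<omega>), eps \<omega>))
    = distr M (borel \<Otimes>\<^sub>M borel) (\<lambda>\<omega>. (X0 \<omega>, eps0 \<omega>)) \<Otimes>\<^sub>M \<nu>"
  using joint_law[of "{0, 2}" "{1}" "\<lambda>f. (f 0, f 2)" "borel \<Otimes>\<^sub>M borel" "\<lambda>f. f 1" borel] by simp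

lemma noise_\<nu>: "L2 \<nu> (\<lambda>y. y)" "(\<integral>y. y \<partial>\<nu>) = 0" "(\<integral>y. y\<^sup>2 \<partial>\<nu>) = 1"
  using eps by (simp_all add: L2_def integrable_distr_eq integral_distr)

lemma noise_\<rho>: "L2 \<rho> (\<lambda>y. y)" "(\<integral>y. y \<partial>\<rho>) = 0" "(\<integral>y. y\<^sup>2 \<partial>\<rho>) = 1"
  using eps0 by (simp_all add: L2_def integrable_distr_eq integral_distr)

text \<open>Both conditional moments are computed by freezing \<open>X0\<close> and integrating over \<open>(eps0, eps)\<close>. The part
  \<open>s(X0) eps\<close> has mean zero and is uncorrelated with the rest, so it adds \<open>s\<^sup>2\<close> to the variance of
  \<open>h(x, \<cdot>)\<close> under \<open>\<rho>\<close>.\<close>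

lemma mean_variance_affine_noise:
  fixes h :: "real \<times> real \<Rightarrow> real" and s :: "real \<Rightarrow> real"
  assumes h [measurable]: "h \<in> borel_measurable (borel \<Otimes>\<^sub>M borel)" and s [measurable]: "s \<in> borel_measurable borel"
    and L2h: "AE x in \<mu>. L2 \<rho> (\<lambda>e. h (x, e))"
    and Y [measurable]: "Y \<in> borel_measurable M"
    and Y_eq: "AE \<omega> in M. Y \<omega> = h (X0 \<omega>, eps0 \<omega>) + s (X0 \<omega>) * eps \<omega>"
  shows "AE \<omega> in M. mean_variance M X0 q Y \<omega> = (\<integral>e. h (X0 \<omega>, e) \<partial>\<rho>)
    - 1 / (2 * q) * ((\<integral>e. (h (X0 \<omega>, e))\<^sup>2 \<partial>\<rho>) - (\<integral>e. h (X0 \<omega>, e) \<partial>\<rho>)\<^sup>2 + (s (X0 \<omega>))\<^sup>2)"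
proof -
  define J where "J x = (\<integral>e. h (x, e) \<partial>\<rho>)" for x
  have [measurable]: "J \<in> borel_measurable borel"
    unfolding J_def by measurable
  let ?G = "vimage_algebra (space M) X0 borel"
  have sub: "subalgebra M ?G"
    unfolding subalgebra_def using sets_vimage_algebra2[of X0 "space M" borel] by auto
  interpret G: finite_measure_subalgebra M ?G
    by unfold_locales (rule sub)
  note freeze = real_cond_exp_freezing[OF _ _ law_X0_noise, unfolded law_noise, OF measurable_X0 measurable_Pair[OF measurable_eps0 measurable_eps]]
  define f where "f = (\<lambda>(x, e, y). h (x, e) + s x * y)"
  have f: "f \<in> borel_measurable (borel \<Otimes>\<^sub>M (borel \<Otimes>\<^sub>M borel))"
    unfolding f_def by measurable
  define g where "g = (\<lambda>(x, e, y). (h (x, e) - J x + s x * y)\<^sup>2)"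
  have g: "g \<in> borel_measurable (borel \<Otimes>\<^sub>M (borel \<Otimes>\<^sub>M borel))"
    unfolding g_def by measurable
  have fm: "integrable (\<rho> \<Otimes>\<^sub>M \<nu>) (\<lambda>w. f (x, w))" "(\<integral>w. f (x, w) \<partial>(\<rho> \<Otimes>\<^sub>M \<nu>)) = J x"
    if "L2 \<rho> (\<lambda>e. h (x, e))" for x
    using \<rho>\<nu>.affine_noise_moments[OF that noise_\<nu>, of "s x"] \<rho>\<nu>.P.L2_integrable
    by (simp_all add: f_def J_def split_beta')
  have gm: "integrable (\<rho> \<Otimes>\<^sub>M \<nu>) (\<lambda>w. g (x, w))"
      "(\<integral>w. g (x, w) \<partial>(\<rho> \<Otimes>\<^sub>M \<nu>)) = (\<integral>e. (h (x, e))\<^sup>2 \<partial>\<rho>) - (J x)\<^sup>2 + (s x)\<^sup>2"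
    if "L2 \<rho> (\<lambda>e. h (x, e))" for x
  proof -
    have "L2 \<rho> (\<lambda>e. h (x, e) - J x)"
      using that \<rho>.L2_const by (rule L2_diff)
    note m = \<rho>\<nu>.affine_noise_moments[OF this noise_\<nu>, of "s x"]
    show "integrable (\<rho> \<Otimes>\<^sub>M \<nu>) (\<lambda>w. g (x, w))"
      using m(1) by (simp add: g_def split_beta' L2_def)
    show "(\<integral>w. g (x, w) \<partial>(\<rho> \<Otimes>\<^sub>M \<nu>)) = (\<integral>e. (h (x, e))\<^sup>2 \<partial>\<rho>) - (J x)\<^sup>2 + (s x)\<^sup>2"
      using m(3) \<rho>.L2_integral_square_diff[OF that, of "J x"]
      by (simp add: g_def split_beta' J_def power2_eq_square)
  qed
  have L2X: "AE \<omega> in M. L2 \<rho> (\<lambda>e. h (X0 \<omega>, e))"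
    using L2h by (rule AE_distrD[rotated]) measurable
  have fM: "(\<lambda>\<omega>. f (X0 \<omega>, eps0 \<omega>, eps \<omega>)) \<in> borel_measurable M"
    and gM: "(\<lambda>\<omega>. g (X0 \<omega>, eps0 \<omega>, eps \<omega>)) \<in> borel_measurable M"
    unfolding f_def g_def by measurable
  have "AE x in \<mu>. integrable (\<rho> \<Otimes>\<^sub>M \<nu>) (\<lambda>w. f (x, w))"
    using L2h by eventually_elim (rule fm)
  note freeze_f = freeze[OF f this]
  have "AE \<omega> in M. Y \<omega> = f (X0 \<omega>, eps0 \<omega>, eps \<omega>)"
    using Y_eq by (simp add: f_def)
  from G.real_cond_exp_cong[OF this Y fM] freeze_f L2X
  have mean: "AE \<omega> in M. real_cond_exp M ?G Y \<omega> = J (X0 \<omega>)"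
    by eventually_elim (simp add: fm)
  have "AE \<omega> in M. (Y \<omega> - real_cond_exp M ?G Y \<omega>)\<^sup>2 = g (X0 \<omega>, eps0 \<omega>, eps \<omega>)"
    using mean Y_eq by eventually_elim (simp add: g_def algebra_simps)
  then have "AE \<omega> in M. cond_variance M ?G Y \<omega> = real_cond_exp M ?G (\<lambda>\<omega>. g (X0 \<omega>, eps0 \<omega>, eps \<omega>)) \<omega>"
    unfolding cond_variance_def by (rule G.real_cond_exp_cong[OF _ _ gM]) measurable
  moreover have "AE x in \<mu>. integrable (\<rho> \<Otimes>\<^sub>M \<nu>) (\<lambda>w. g (x, w))"
    using L2h by eventually_elim (rule gm)
  note freeze[OF g this]
  ultimately have var: "AE \<omega> in M. cond_variance M ?G Y \<omega>
    = (\<integral>e. (h (X0 \<omega>, e))\<^sup>2 \<partial>\<rho>) - (J (X0 \<omega>))\<^sup>2 + (s (X0 \<omega>))\<^sup>2"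
    using L2X by eventually_elim (simp add: gm)
  show ?thesis
    using mean var by eventually_elim (simp add: mean_variance_def sigma_gen_def J_def)
qed

section \<open>Increments in a random environment\<close>

text \<open>The coefficient of the increment at \<open>x\<close>: the initial unit plus the total share of \<open>x\<close> that all
  others hold. Its counterpart \<open>holdings\<close> is the total share that \<open>x\<close> holds in the others.\<close>

definition held :: "real \<Rightarrow> real" where
  "held x = 1 + (\<integral>y. \<pi> (y, x) \<partial>\<mu>)"

definition holdings :: "real \<Rightarrow> real" where
  "holdings x = (\<integral>y. \<pi> (x, y) \<partial>\<mu>)"

abbreviation "is_inc F \<beta> D \<equiv> is_increment M X0 eps eps0 b \<sigma> \<sigma>0 F \<pi> \<beta> D"
abbreviation "equilibrium F \<equiv> mean_field_equilibrium M X0 eps eps0 b \<sigma> \<sigma>0 q F \<pi>"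

lemma measurable_\<pi> [measurable]: "\<pi> \<in> borel_measurable (borel \<Otimes>\<^sub>M borel)"
  using L2_measurable[OF L2_\<pi>] by simp

lemma measurable_held [measurable]: "held \<in> borel_measurable borel"
  unfolding held_def by measurable

lemma measurable_holdings [measurable]: "holdings \<in> borel_measurable borel"
  unfolding holdings_def by measurable

lemma AE_\<mu>: "AE x in \<mu>. P x \<Longrightarrow> AE \<omega> in M. P (X0 \<omega>)"
  by (rule AE_distrD) measurable

lemma AE_\<rho>: "AE x in \<rho>. P x \<Longrightarrow> AE \<omega> in M. P (eps0 \<omega>)"
  by (rule AE_distrD) measurable

lemma AE_\<mu>\<rho>_iff:
  assumes [measurable]: "Measurable.pred (borel \<Otimes>\<^sub>M borel) P"
  shows "(AE z in \<mu> \<Otimes>\<^sub>M \<rho>. P z) \<longleftrightarrow> (AE \<omega> in M. P (X0 \<omega>, eps0 \<omega>))"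
  unfolding law_X0_eps0[symmetric] by (rule AE_distr_iff) measurable

lemma L2_\<mu>\<rho>_iff:
  assumes [measurable]: "f \<in> borel_measurable (borel \<Otimes>\<^sub>M borel)"
  shows "L2 (\<mu> \<Otimes>\<^sub>M \<rho>) f \<longleftrightarrow> L2 M (\<lambda>\<omega>. f (X0 \<omega>, eps0 \<omega>))"
  unfolding law_X0_eps0[symmetric] by (simp add: L2_def integrable_distr_eq)

lemma L2_\<mu>\<nu>_iff:
  assumes [measurable]: "f \<in> borel_measurable (borel \<Otimes>\<^sub>M borel)"
  shows "L2 (\<mu> \<Otimes>\<^sub>M \<nu>) f \<longleftrightarrow> L2 M (\<lambda>\<omega>. f (X0 \<omega>, eps \<omega>))"
  unfolding law_X0_eps[symmetric] by (simp add: L2_def integrable_distr_eq)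

lemma \<pi>_integrable: "AE \<omega> in M. integrable \<mu> (\<lambda>y. \<pi> (y, X0 \<omega>))"
proof (rule AE_\<mu>)
  show "AE x in \<mu>. integrable \<mu> (\<lambda>y. \<pi> (y, x))"
    using \<mu>\<mu>.L2_AE_section_snd[OF L2_\<pi>] by eventually_elim (rule \<mu>.L2_integrable)
qed

lemma \<pi>_section_integrable: "AE \<omega> in M. integrable \<mu> (\<lambda>y. \<pi> (X0 \<omega>, y))"
proof (rule AE_\<mu>)
  show "AE x in \<mu>. integrable \<mu> (\<lambda>y. \<pi> (x, y))"
    using \<mu>\<mu>.L2_AE_section_fst[OF L2_\<pi>] by eventually_elim (rule \<mu>.L2_integrable)
qed

text \<open>Every share counted in \<open>holdings\<close> is counted in \<open>held\<close>: both integrate \<open>\<pi>\<close> over \<open>\<mu> \<Otimes> \<mu>\<close>, up to the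
  initial unit in \<open>held\<close>. This identifies the level of the equilibrium as \<open>E[b(X0)]\<close>.\<close>

lemma integral_held_minus_holdings:
  "integrable \<mu> (\<lambda>x. held x - holdings x)" "(\<integral>x. held x - holdings x \<partial>\<mu>) = 1"
proof -
  have i: "integrable (\<mu> \<Otimes>\<^sub>M \<mu>) (\<lambda>(x, y). \<pi> (x, y))"
    using \<mu>\<mu>.P.L2_integrable[OF L2_\<pi>] by simp
  have 1: "integrable \<mu> held" "integrable \<mu> holdings"
    using \<mu>\<mu>.integrable_fst[OF i] \<mu>\<mu>.integrable_snd[OF i]
    by (auto simp: held_def[abs_def] holdings_def[abs_def])
  then show "integrable \<mu> (\<lambda>x. held x - holdings x)" by simp
  have "(\<integral>x. held x \<partial>\<mu>) = 1 + (\<integral>x. holdings x \<partial>\<mu>)"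
    using \<mu>\<mu>.integral_fst[OF i] \<mu>\<mu>.integral_snd[OF i] \<mu>\<mu>.integrable_snd[OF i]
    using \<mu>.prob_space by (simp add: held_def holdings_def)
  then show "(\<integral>x. held x - holdings x \<partial>\<mu>) = 1"
    using 1 by simp
qed

text \<open>Where \<open>held\<close> vanishes, the equation reads \<open>r(x, e) + \<sigma>(x) eps = 0\<close>. For fixed \<open>(x, e)\<close> this would make
  a standardized variable constant, since \<open>\<sigma>(x) \<noteq> 0\<close>.\<close>

lemma held_nonzero:
  fixes r :: "real \<times> real \<Rightarrow> real"
  assumes [measurable]: "r \<in> borel_measurable (borel \<Otimes>\<^sub>M borel)"
    and eq: "AE \<omega> in M. held (X0 \<omega>) * D \<omega> = r (X0 \<omega>, eps0 \<omega>) + \<sigma> (X0 \<omega>) * eps \<omega>"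
  shows "AE x in \<mu>. held x \<noteq> 0"
proof -
  define Q where "Q z \<longleftrightarrow> (held (fst (fst z)) = 0 \<longrightarrow>
      \<sigma> (fst (fst z)) \<noteq> 0 \<and> r (fst z) + \<sigma> (fst (fst z)) * snd z = 0)"
    for z :: "(real \<times> real) \<times> real"
  have Q [measurable]: "Measurable.pred ((borel \<Otimes>\<^sub>M borel) \<Otimes>\<^sub>M borel) Q"
    unfolding Q_def by measurable
  have "AE \<omega> in M. Q ((X0 \<omega>, eps0 \<omega>), eps \<omega>)"
    using eq nz_\<sigma> by eventually_elim (auto simp: Q_def)
  then have "AE z in distr M ((borel \<Otimes>\<^sub>M borel) \<Otimes>\<^sub>M borel) (\<lambda>\<omega>. ((X0 \<omega>, eps0 \<omega>), eps \<omega>)). Q z"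
    by (subst AE_distr_iff) measurable
  then have "AE z in \<mu> \<Otimes>\<^sub>M \<rho>. AE y in \<nu>. Q (z, y)"
    unfolding law_X0_eps0_eps law_X0_eps0 by (rule \<mu>\<rho>_\<nu>.AE_pair)
  then have "AE z in \<mu> \<Otimes>\<^sub>M \<rho>. held (fst z) \<noteq> 0"
  proof eventually_elim
    case (elim z)
    show ?case
    proof
      assume "held (fst z) = 0"
      then have "AE y in \<nu>. r z + \<sigma> (fst z) * y = 0"
        using elim by (auto simp: Q_def elim!: eventually_mono)
      from \<nu>.standardized_AE_affine_zero[OF noise_\<nu> this] have "\<sigma> (fst z) = 0"
        by simp
      moreover have "AE y in \<nu>. \<sigma> (fst z) \<noteq> 0"
        using elim \<open>held (fst z) = 0\<close> by (auto simp: Q_def elim!: eventually_mono)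
      ultimately show False
        by simp
    qed
  qed
  from \<mu>\<rho>.AE_pair[OF this] show ?thesis
    by simp
qed

text \<open>Dividing by \<open>held\<close> shows that increments are almost surely unique and that the strategy only enters the part that is a
  function of \<open>(X0, eps0)\<close>.\<close>

lemma increment_form:
  assumes [measurable]: "F \<in> borel_measurable (borel \<Otimes>\<^sub>M borel)" "\<beta> \<in> borel_measurable (borel \<Otimes>\<^sub>M borel)"
    and inc: "is_inc F \<beta> D"
  shows "AE x in \<mu>. held x \<noteq> 0"
    and "AE \<omega> in M. D \<omega> = (b (X0 \<omega>) + \<sigma>0 (X0 \<omega>) * eps0 \<omega> + (\<integral>y. \<beta> (X0 \<omega>, y) * F (y, eps0 \<omega>) \<partial>\<mu>)) / held (X0 \<omega>)
      + \<sigma> (X0 \<omega>) / held (X0 \<omega>) * eps \<omega>"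
proof -
  have eq: "AE \<omega> in M. held (X0 \<omega>) * D \<omega> =
      (b (X0 \<omega>) + \<sigma>0 (X0 \<omega>) * eps0 \<omega> + (\<integral>y. \<beta> (X0 \<omega>, y) * F (y, eps0 \<omega>) \<partial>\<mu>)) + \<sigma> (X0 \<omega>) * eps \<omega>"
    using inc by (auto simp: is_increment_def held_def algebra_simps)
  show nz: "AE x in \<mu>. held x \<noteq> 0"
    by (rule held_nonzero[where D = D and r = "\<lambda>(x, e). b x + \<sigma>0 x * e + (\<integral>y. \<beta> (x, y) * F (y, e) \<partial>\<mu>)"])
       (use eq in auto)
  from eq AE_\<mu>[OF nz]
  show "AE \<omega> in M. D \<omega> = (b (X0 \<omega>) + \<sigma>0 (X0 \<omega>) * eps0 \<omega> + (\<integral>y. \<beta> (X0 \<omega>, y) * F (y, eps0 \<omega>) \<partial>\<mu>)) / held (X0 \<omega>)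
      + \<sigma> (X0 \<omega>) / held (X0 \<omega>) * eps \<omega>"
    by eventually_elim (simp add: field_simps)
qed

lemma cond_exp_affine_noise:
  assumes [measurable]: "h \<in> borel_measurable (borel \<Otimes>\<^sub>M borel)" "s \<in> borel_measurable borel"
    and D [measurable]: "D \<in> borel_measurable M"
    and D_eq: "AE \<omega> in M. D \<omega> = h (X0 \<omega>, eps0 \<omega>) + s (X0 \<omega>) * eps \<omega>"
  shows "AE \<omega> in M. real_cond_exp M (sigma_gen M (\<lambda>\<omega>. (X0 \<omega>, eps0 \<omega>))) D \<omega> = h (X0 \<omega>, eps0 \<omega>)"
proof -
  let ?G = "vimage_algebra (space M) (\<lambda>\<omega>. (X0 \<omega>, eps0 \<omega>)) (borel \<Otimes>\<^sub>M borel)"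
  define f where "f z = h (fst z) + s (fst (fst z)) * snd z" for z
  have f: "f \<in> borel_measurable ((borel \<Otimes>\<^sub>M borel) \<Otimes>\<^sub>M borel)"
    unfolding f_def by measurable
  have fM: "(\<lambda>\<omega>. f ((X0 \<omega>, eps0 \<omega>), eps \<omega>)) \<in> borel_measurable M"
    unfolding f_def by measurable
  have int: "integrable \<nu> (\<lambda>y. f (z, y))" "(\<integral>y. f (z, y) \<partial>\<nu>) = h z" for z
    using \<nu>.L2_integrable[OF noise_\<nu>(1)] noise_\<nu>(2)
    using \<nu>.prob_space by (auto simp: f_def)
  have "AE \<omega> in M. real_cond_exp M ?G (\<lambda>\<omega>. f ((X0 \<omega>, eps0 \<omega>), eps \<omega>)) \<omega>
    = (\<integral>y. f ((X0 \<omega>, eps0 \<omega>), y) \<partial>\<nu>)"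
    by (rule real_cond_exp_freezing[OF _ _ law_X0_eps0_eps f]) (auto intro!: AE_I2 int)
  moreover have sub: "subalgebra M ?G"
    unfolding subalgebra_def
    using sets_vimage_algebra2[of "\<lambda>\<omega>. (X0 \<omega>, eps0 \<omega>)" "space M" "borel \<Otimes>\<^sub>M borel"]
    by (auto simp: space_pair_measure)
  then interpret G: finite_measure_subalgebra M ?G
    by unfold_locales
  have "AE \<omega> in M. D \<omega> = f ((X0 \<omega>, eps0 \<omega>), eps \<omega>)"
    using D_eq by (simp add: f_def)
  note G.real_cond_exp_cong[OF this D fM]
  ultimately have "AE \<omega> in M. real_cond_exp M ?G D \<omega> = h (X0 \<omega>, eps0 \<omega>)"
    by eventually_elim (simp add: int)
  then show ?thesis
    by (simp add: sigma_gen_def borel_prod)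
qed

text \<open>The consistency condition replaces the common part of the increment by \<open>F(X0, eps0)\<close>. Comparing the two
  expressions for it is the Fredholm equation.\<close>

lemma equilibrium_increment:
  assumes F: "L2 (\<mu> \<Otimes>\<^sub>M \<rho>) F" and eq: "equilibrium F"
  obtains D where "is_inc F \<pi> D" "L2 M (\<lambda>\<omega>. X0 \<omega> + D \<omega>)"
    "AE \<omega> in M. D \<omega> = F (X0 \<omega>, eps0 \<omega>) + \<sigma> (X0 \<omega>) / held (X0 \<omega>) * eps \<omega>"
    "AE x in \<mu>. held x \<noteq> 0"
    "AE z in \<mu> \<Otimes>\<^sub>M \<rho>. held (fst z) * F z = b (fst z) + \<sigma>0 (fst z) * snd z + (\<integral>y. \<pi> (fst z, y) * F (y, snd z) \<partial>\<mu>)"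
proof -
  have [measurable]: "F \<in> borel_measurable (borel \<Otimes>\<^sub>M borel)"
    using L2_measurable[OF F] by simp
  from eq obtain D where inc: "is_inc F \<pi> D" and L2: "L2 M (\<lambda>\<omega>. X0 \<omega> + D \<omega>)"
    by (auto simp: mean_field_equilibrium_def admissible_def)
  then have [measurable]: "D \<in> borel_measurable M"
    by (simp add: is_increment_def)
  note form = increment_form[OF _ _ inc, simplified]
  let ?h = "\<lambda>(x, e). (b x + \<sigma>0 x * e + (\<integral>y. \<pi> (x, y) * F (y, e) \<partial>\<mu>)) / held x"
  have h: "?h \<in> borel_measurable (borel \<Otimes>\<^sub>M borel)"
    by measurable
  have D: "AE \<omega> in M. D \<omega> = ?h (X0 \<omega>, eps0 \<omega>) + \<sigma> (X0 \<omega>) / held (X0 \<omega>) * eps \<omega>"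
    using form(2) by simp
  have s: "(\<lambda>x. \<sigma> x / held x) \<in> borel_measurable borel" by measurable
  from cond_exp_affine_noise[OF h s _ D] eq inc
  have Fh: "AE \<omega> in M. F (X0 \<omega>, eps0 \<omega>) = ?h (X0 \<omega>, eps0 \<omega>)"
    unfolding mean_field_equilibrium_def by (auto elim: eventually_elim2)
  show thesis
  proof
    show "AE \<omega> in M. D \<omega> = F (X0 \<omega>, eps0 \<omega>) + \<sigma> (X0 \<omega>) / held (X0 \<omega>) * eps \<omega>"
      using D Fh by eventually_elim simp
    show nz: "AE x in \<mu>. held x \<noteq> 0" by (rule form)
    show "AE z in \<mu> \<Otimes>\<^sub>M \<rho>. held (fst z) * F z = b (fst z) + \<sigma>0 (fst z) * snd z + (\<integral>y. \<pi> (fst z, y) * F (y, snd z) \<partial>\<mu>)"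
    proof (subst AE_\<mu>\<rho>_iff)
      show "AE \<omega> in M. held (fst (X0 \<omega>, eps0 \<omega>)) * F (X0 \<omega>, eps0 \<omega>) =
          b (fst (X0 \<omega>, eps0 \<omega>)) + \<sigma>0 (fst (X0 \<omega>, eps0 \<omega>)) * snd (X0 \<omega>, eps0 \<omega>) +
          (\<integral>y. \<pi> (fst (X0 \<omega>, eps0 \<omega>), y) * F (y, snd (X0 \<omega>, eps0 \<omega>)) \<partial>\<mu>)"
        using Fh AE_\<mu>[OF nz] by eventually_elim (simp add: field_simps)
    qed measurable
  qed fact+
qed

text \<open>Subtracting \<open>F(X0, eps0)\<close> from the terminal state leaves \<open>X0 + s(X0) eps\<close> with \<open>s = \<sigma> / held\<close>. Its second
  moment given \<open>X0 = x\<close> is the sum \<open>x\<^sup>2 + s(x)\<^sup>2\<close>, so both terms are integrable.\<close>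

lemma equilibrium_imp_L2:
  assumes F: "L2 (\<mu> \<Otimes>\<^sub>M \<rho>) F" and eq: "equilibrium F"
  shows "L2 M X0" "L2 \<mu> (\<lambda>x. \<sigma> x / held x)"
proof -
  have [measurable]: "F \<in> borel_measurable (borel \<Otimes>\<^sub>M borel)"
    using L2_measurable[OF F] by simp
  obtain D where L2: "L2 M (\<lambda>\<omega>. X0 \<omega> + D \<omega>)"
    and D: "AE \<omega> in M. D \<omega> = F (X0 \<omega>, eps0 \<omega>) + \<sigma> (X0 \<omega>) / held (X0 \<omega>) * eps \<omega>"
    by (rule equilibrium_increment[OF F eq])
  define s where "s x = \<sigma> x / held x" for x
  have [measurable]: "s \<in> borel_measurable borel"
    unfolding s_def by measurable
  have moment: "(\<integral>y. (x + s x * y)\<^sup>2 \<partial>\<nu>) = x\<^sup>2 + (s x)\<^sup>2" for x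
    by (rule \<nu>.standardized_affine_moments(2)[OF noise_\<nu>])
  have "L2 M (\<lambda>\<omega>. F (X0 \<omega>, eps0 \<omega>))"
    using F by (simp add: L2_\<mu>\<rho>_iff)
  from L2_diff[OF L2 this] have "L2 M (\<lambda>\<omega>. X0 \<omega> + s (X0 \<omega>) * eps \<omega>)"
    by (rule L2_AE_cong) (use D in \<open>auto simp: s_def elim!: eventually_mono\<close>)
  then have "L2 (\<mu> \<Otimes>\<^sub>M \<nu>) (\<lambda>z. fst z + s (fst z) * snd z)"
    by (subst L2_\<mu>\<nu>_iff) simp_all
  then have "integrable (\<mu> \<Otimes>\<^sub>M \<nu>) (\<lambda>z. (fst z + s (fst z) * snd z)\<^sup>2)"
    by (simp add: L2_def)
  from \<mu>\<nu>.integrable_fst'[OF this] have "integrable \<mu> (\<lambda>x. \<integral>y. (x + s x * y)\<^sup>2 \<partial>\<nu>)"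
    by simp
  with moment have int: "integrable \<mu> (\<lambda>x. x\<^sup>2 + (s x)\<^sup>2)"
    by simp
  have "integrable \<mu> (\<lambda>x. x\<^sup>2)" "integrable \<mu> (\<lambda>x. (s x)\<^sup>2)"
    by (rule Bochner_Integration.integrable_bound[OF int]; simp)+
  then show "L2 M X0" "L2 \<mu> (\<lambda>x. \<sigma> x / held x)"
    by (simp_all add: L2_def integrable_distr_eq s_def)
qed

section \<open>The form of an equilibrium\<close>

text \<open>The factor \<open>held(x)\<close> in the perturbation \<open>t held(x) \<phi>(y)\<close> of \<open>\<pi>\<close> cancels the coefficient of the
  increment. The increment then moves by \<open>t \<Phi>(eps0)\<close>, which does not involve \<open>X0\<close> and is square
  integrable, so the perturbed strategy is admissible whatever the size of \<open>1 / held\<close>.\<close>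

lemma first_order_condition:
  fixes \<phi> :: "real \<Rightarrow> real" and K :: real
  assumes F: "L2 (\<mu> \<Otimes>\<^sub>M \<rho>) F" and eq: "equilibrium F"
    and \<phi> [measurable]: "\<phi> \<in> borel_measurable borel" and bnd: "\<And>x. \<bar>\<phi> x\<bar> \<le> K"
  defines "\<Phi> \<equiv> \<lambda>e. \<integral>y. \<phi> y * F (y, e) \<partial>\<mu>"
  shows "AE x in \<mu>. q * (\<integral>e. \<Phi> e \<partial>\<rho>) = (\<integral>e. F (x, e) * \<Phi> e \<partial>\<rho>) - (\<integral>e. F (x, e) \<partial>\<rho>) * (\<integral>e. \<Phi> e \<partial>\<rho>)"
proof -
  have Fm [measurable]: "F \<in> borel_measurable (borel \<Otimes>\<^sub>M borel)"
    using L2_measurable[OF F] by simp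
  obtain D where inc: "is_inc F \<pi> D" and L2: "L2 M (\<lambda>\<omega>. X0 \<omega> + D \<omega>)"
    and D: "AE \<omega> in M. D \<omega> = F (X0 \<omega>, eps0 \<omega>) + \<sigma> (X0 \<omega>) / held (X0 \<omega>) * eps \<omega>"
    by (rule equilibrium_increment[OF F eq])
  from inc have [measurable]: "D \<in> borel_measurable M"
    by (simp add: is_increment_def)
  have L2\<Phi>: "L2 \<rho> \<Phi>"
    unfolding \<Phi>_def by (rule \<mu>\<rho>.L2_average[OF F _ bnd]) simp
  have [measurable]: "\<Phi> \<in> borel_measurable borel"
    unfolding \<Phi>_def by measurable
  have L2F: "AE x in \<mu>. L2 \<rho> (\<lambda>e. F (x, e))"
    by (rule \<mu>\<rho>.L2_AE_section_fst[OF F])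
  define \<beta> where "\<beta> t = (\<lambda>(x, y). \<pi> (x, y) + t * held x * \<phi> y)" for t :: real
  have \<beta>m [measurable]: "\<beta> t \<in> borel_measurable (borel \<Otimes>\<^sub>M borel)" for t
    unfolding \<beta>_def by measurable
  have \<phi>F: "AE \<omega> in M. integrable \<mu> (\<lambda>y. \<phi> y * F (y, eps0 \<omega>))"
  proof (rule AE_\<rho>)
    show "AE e in \<rho>. integrable \<mu> (\<lambda>y. \<phi> y * F (y, e))"
      using \<mu>\<rho>.L2_AE_section_snd[OF F]
      by eventually_elim (rule \<mu>.L2_integrable, rule L2_bounded_mult[OF _ _ bnd], simp_all)
  qed
  have inc\<beta>: "is_inc F (\<beta> t) (\<lambda>\<omega>. D \<omega> + t * \<Phi> (eps0 \<omega>))" for t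
  proof -
    have \<pi>F: "AE \<omega> in M. integrable \<mu> (\<lambda>y. \<pi> (X0 \<omega>, y) * F (y, eps0 \<omega>))"
      using inc by (simp add: is_increment_def)
    from \<pi>F \<phi>F have split: "AE \<omega> in M. integrable \<mu> (\<lambda>y. \<beta> t (X0 \<omega>, y) * F (y, eps0 \<omega>)) \<and>
      (\<integral>y. \<beta> t (X0 \<omega>, y) * F (y, eps0 \<omega>) \<partial>\<mu>)
        = (\<integral>y. \<pi> (X0 \<omega>, y) * F (y, eps0 \<omega>) \<partial>\<mu>) + t * held (X0 \<omega>) * \<Phi> (eps0 \<omega>)"
    proof eventually_elim
      case (elim \<omega>)
      have *: "\<beta> t (X0 \<omega>, y) * F (y, eps0 \<omega>) =
          \<pi> (X0 \<omega>, y) * F (y, eps0 \<omega>) + t * held (X0 \<omega>) * (\<phi> y * F (y, eps0 \<omega>))" for y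
        by (simp add: \<beta>_def algebra_simps)
      show ?case
        unfolding * using elim by (simp add: \<Phi>_def)
    qed
    have "AE \<omega> in M. held (X0 \<omega>) * (D \<omega> + t * \<Phi> (eps0 \<omega>)) = b (X0 \<omega>) + \<sigma> (X0 \<omega>) * eps \<omega>
      + \<sigma>0 (X0 \<omega>) * eps0 \<omega> + (\<integral>y. \<beta> t (X0 \<omega>, y) * F (y, eps0 \<omega>) \<partial>\<mu>)"
    proof -
      have "AE \<omega> in M. held (X0 \<omega>) * D \<omega> = b (X0 \<omega>) + \<sigma> (X0 \<omega>) * eps \<omega>
        + \<sigma>0 (X0 \<omega>) * eps0 \<omega> + (\<integral>y. \<pi> (X0 \<omega>, y) * F (y, eps0 \<omega>) \<partial>\<mu>)"
        using inc by (simp add: is_increment_def held_def)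
      then show ?thesis
        using split by eventually_elim (simp add: algebra_simps)
    qed
    moreover have "AE \<omega> in M. integrable \<mu> (\<lambda>y. \<beta> t (X0 \<omega>, y) * F (y, eps0 \<omega>))"
      using split by eventually_elim simp
    ultimately show ?thesis
      unfolding is_increment_def held_def[symmetric] using \<pi>_integrable by auto
  qed
  have L2\<Phi>M: "L2 M (\<lambda>\<omega>. \<Phi> (eps0 \<omega>))"
    using L2\<Phi> by (simp add: L2_def integrable_distr_eq)
  have "L2 M (\<lambda>\<omega>. X0 \<omega> + (D \<omega> + t * \<Phi> (eps0 \<omega>)))" for t
    using L2_add[OF L2 L2_cmult[OF L2\<Phi>M, of t]] by (simp add: add.assoc)
  with inc\<beta> have adm: "\<beta> t \<in> admissible M X0 eps eps0 b \<sigma> \<sigma>0 F \<pi>" for t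
    by (auto simp: admissible_def cross_holding_strategy_def)
  have opt: "AE \<omega> in M. mean_variance M X0 q (\<lambda>\<omega>. X0 \<omega> + (D \<omega> + t * \<Phi> (eps0 \<omega>))) \<omega>
    \<le> mean_variance M X0 q (\<lambda>\<omega>. X0 \<omega> + D \<omega>) \<omega>" for t
    using eq inc adm[of t] inc\<beta>[of t] unfolding mean_field_equilibrium_def by blast
  define h where "h t = (\<lambda>(x, e). x + F (x, e) + t * \<Phi> e)" for t
  have hm: "h t \<in> borel_measurable (borel \<Otimes>\<^sub>M borel)" for t
    unfolding h_def by measurable
  have L2h: "L2 \<rho> (\<lambda>e. h t (x, e))" if "L2 \<rho> (\<lambda>e. F (x, e))" for t x
    using L2_add[OF L2_add[OF \<rho>.L2_const that] L2_cmult[OF L2\<Phi>]] by (simp add: h_def)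
  define s where "s x = \<sigma> x / held x" for x
  have s: "s \<in> borel_measurable borel"
    unfolding s_def by measurable
  have MV: "AE \<omega> in M. mean_variance M X0 q (\<lambda>\<omega>. X0 \<omega> + (D \<omega> + t * \<Phi> (eps0 \<omega>))) \<omega> = (\<integral>e. h t (X0 \<omega>, e) \<partial>\<rho>)
    - 1 / (2 * q) * ((\<integral>e. (h t (X0 \<omega>, e))\<^sup>2 \<partial>\<rho>) - (\<integral>e. h t (X0 \<omega>, e) \<partial>\<rho>)\<^sup>2 + (s (X0 \<omega>))\<^sup>2)" for t
  proof (rule mean_variance_affine_noise[OF hm s])
    show "AE x in \<mu>. L2 \<rho> (\<lambda>e. h t (x, e))"
      using L2F by eventually_elim (rule L2h)
    show "AE \<omega> in M. X0 \<omega> + (D \<omega> + t * \<Phi> (eps0 \<omega>)) = h t (X0 \<omega>, eps0 \<omega>) + s (X0 \<omega>) * eps \<omega>"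
      using D by eventually_elim (simp add: h_def s_def)
  qed measurable
  define c where "c = (\<integral>e. \<Phi> e \<partial>\<rho>)"
  define w where "w = ((\<integral>e. (\<Phi> e)\<^sup>2 \<partial>\<rho>) - c\<^sup>2) / (2 * q)"
  define cov where "cov x = (\<integral>e. F (x, e) * \<Phi> e \<partial>\<rho>) - (\<integral>e. F (x, e) \<partial>\<rho>) * c" for x
  \<comment> \<open>The criterion is a quadratic polynomial in \<open>t\<close>; its linear coefficient is \<open>c - cov / q\<close>.\<close>
  have "AE \<omega> in M. t * (c - cov (X0 \<omega>) / q) \<le> t\<^sup>2 * w" for t
    using opt[of t] MV[of t] MV[of 0, simplified] AE_\<mu>[OF L2F]
  proof eventually_elim
    case (elim \<omega>)
    let ?x = "X0 \<omega>"
    let ?a = "\<lambda>e. h 0 (?x, e)"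
    have L2a: "L2 \<rho> ?a" using elim by (intro L2h)
    have ht: "h t (?x, e) = ?a e + t * \<Phi> e" for e
      by (simp add: h_def)
    have int: "integrable \<rho> ?a" "integrable \<rho> \<Phi>" "integrable \<rho> (\<lambda>e. F (?x, e))"
      "integrable \<rho> (\<lambda>e. ?a e * \<Phi> e)" "integrable \<rho> (\<lambda>e. (?a e)\<^sup>2)" "integrable \<rho> (\<lambda>e. (\<Phi> e)\<^sup>2)"
      "integrable \<rho> (\<lambda>e. F (?x, e) * \<Phi> e)"
      using \<rho>.L2_integrable[OF L2a] \<rho>.L2_integrable[OF L2\<Phi>] L2_times_integrable[OF L2a L2\<Phi>]
        L2_times_integrable[OF elim(4) L2\<Phi>] \<rho>.L2_integrable[OF elim(4)] L2a L2\<Phi>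
      unfolding L2_def by blast+
    have p1: "measure \<rho> UNIV = 1" using \<rho>.prob_space by simp
    have I1: "(\<integral>e. h t (?x, e) \<partial>\<rho>) = (\<integral>e. ?a e \<partial>\<rho>) + t * c"
      unfolding ht using int by (simp add: c_def)
    have "(\<integral>e. (h t (?x, e))\<^sup>2 \<partial>\<rho>) = (\<integral>e. (?a e)\<^sup>2 + (2 * t) * (?a e * \<Phi> e) + t\<^sup>2 * (\<Phi> e)\<^sup>2 \<partial>\<rho>)"
      unfolding ht by (intro Bochner_Integration.integral_cong) (auto simp: power2_sum power_mult_distrib)
    also have "\<dots> = (\<integral>e. (?a e)\<^sup>2 \<partial>\<rho>) + 2 * t * (\<integral>e. ?a e * \<Phi> e \<partial>\<rho>) + t\<^sup>2 * (\<integral>e. (\<Phi> e)\<^sup>2 \<partial>\<rho>)"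
      using int by simp
    finally have I2: "(\<integral>e. (h t (?x, e))\<^sup>2 \<partial>\<rho>) = \<dots>" .
    have "(\<integral>e. ?a e \<partial>\<rho>) = ?x + (\<integral>e. F (?x, e) \<partial>\<rho>)"
      using int p1 by (simp add: h_def)
    moreover have "(\<integral>e. ?a e * \<Phi> e \<partial>\<rho>) = ?x * c + (\<integral>e. F (?x, e) * \<Phi> e \<partial>\<rho>)"
      using int by (simp add: h_def distrib_right c_def)
    ultimately have cov: "(\<integral>e. ?a e * \<Phi> e \<partial>\<rho>) - (\<integral>e. ?a e \<partial>\<rho>) * c = cov ?x"
      by (simp add: cov_def algebra_simps)
    define A where "A = (\<integral>e. ?a e \<partial>\<rho>)"
    define B where "B = (\<integral>e. (?a e)\<^sup>2 \<partial>\<rho>)"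
    define C where "C = (\<integral>e. ?a e * \<Phi> e \<partial>\<rho>)"
    have le: "A + t * c - 1 / (2 * q) * (B + 2 * t * C + t\<^sup>2 * (\<integral>e. (\<Phi> e)\<^sup>2 \<partial>\<rho>) - (A + t * c)\<^sup>2 + (s ?x)\<^sup>2)
      \<le> A - 1 / (2 * q) * (B - A\<^sup>2 + (s ?x)\<^sup>2)"
      using elim I1 I2 unfolding A_def B_def C_def by simp
    have cov': "C = cov ?x + A * c"
      using cov unfolding A_def B_def C_def by simp
    have "A + t * c - 1 / (2 * q) * (B + 2 * t * C + t\<^sup>2 * (\<integral>e. (\<Phi> e)\<^sup>2 \<partial>\<rho>) - (A + t * c)\<^sup>2 + (s ?x)\<^sup>2)
      - (A - 1 / (2 * q) * (B - A\<^sup>2 + (s ?x)\<^sup>2)) = t * (c - cov ?x / q) - t\<^sup>2 * w"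
      unfolding cov' w_def using q_pos by (simp add: field_simps power2_eq_square)
    with le show ?case by linarith
  qed
  then have "AE \<omega> in M. \<forall>k :: int. 1 / of_int k * (c - cov (X0 \<omega>) / q) \<le> (1 / of_int k)\<^sup>2 * w"
    unfolding AE_all_countable by (intro allI)
  then have "AE \<omega> in M. q * c = cov (X0 \<omega>)"
  proof eventually_elim
    case (elim \<omega>)
    have "c - cov (X0 \<omega>) / q = 0"
    proof (rule zero_if_int_multiples_bounded)
      fix k :: int assume "k \<noteq> 0"
      then have k: "(real_of_int k)\<^sup>2 > 0" by simp
      have "(of_int k)\<^sup>2 * (1 / of_int k * (c - cov (X0 \<omega>) / q)) \<le> (of_int k)\<^sup>2 * ((1 / of_int k)\<^sup>2 * w)"
        using elim k by (intro mult_left_mono) auto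
      then show "of_int k * (c - cov (X0 \<omega>) / q) \<le> w"
        using \<open>k \<noteq> 0\<close> by (simp add: power2_eq_square)
    qed
    then show ?case using q_pos by (simp add: field_simps)
  qed
  moreover have "cov \<in> borel_measurable borel"
    unfolding cov_def by measurable
  ultimately show ?thesis
    by (subst AE_distr_iff) (simp_all add: cov_def c_def)
qed

text \<open>The Fredholm integral runs over the first argument of \<open>F\<close> at a fixed value of the noise, so null sets
  have to be sliced in this order.\<close>

lemma AE_\<rho>\<mu>_swap:
  assumes [measurable]: "Measurable.pred (borel \<Otimes>\<^sub>M borel) P" and ae: "AE z in \<mu> \<Otimes>\<^sub>M \<rho>. P z"
  shows "AE e in \<rho>. AE x in \<mu>. P (x, e)"
proof -
  have "AE x in \<mu>. AE e in \<rho>. P (x, e)"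
    using ae by (rule \<mu>\<rho>.AE_pair)
  moreover have "{z \<in> space (borel \<Otimes>\<^sub>M borel). P z} \<in> sets (borel \<Otimes>\<^sub>M borel)"
    by measurable
  ultimately show ?thesis
    using \<mu>\<rho>.AE_commute[of "\<lambda>x e. P (x, e)"] by (simp add: space_pair_measure)
qed

text \<open>Once \<open>F(x, e) = g(e)\<close>, the Fredholm equation is \<open>(held - holdings)(x) g(e) = b(x) + \<sigma>0(x) e\<close>. A single
  point \<open>x0\<close> outside the null sets, with \<open>\<sigma>0(x0) \<noteq> 0\<close>, shows that \<open>g\<close> is affine with nonzero slope;
  comparing coefficients at the other points gives \<open>b\<close> and \<open>\<sigma>0\<close>.\<close>

lemma equilibrium_structure:
  assumes F: "L2 (\<mu> \<Otimes>\<^sub>M \<rho>) F" and eq: "equilibrium F"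
  defines "m \<equiv> (\<integral>x. b x \<partial>\<mu>)"
  obtains lam where "m > 0" "lam\<^sup>2 = q / m" "AE x in \<mu>. \<sigma>0 x = lam * b x"
    "AE x in \<mu>. held x \<noteq> 0 \<and> held x - holdings x = b x / m"
    "AE z in \<mu> \<Otimes>\<^sub>M \<rho>. F z = m * (1 + lam * snd z)"
proof -
  have Fm [measurable]: "F \<in> borel_measurable (borel \<Otimes>\<^sub>M borel)"
    using L2_measurable[OF F] by simp
  obtain D :: "'a \<Rightarrow> real" where nz: "AE x in \<mu>. held x \<noteq> 0"
    and fred: "AE z in \<mu> \<Otimes>\<^sub>M \<rho>. held (fst z) * F z = b (fst z) + \<sigma>0 (fst z) * snd z + (\<integral>y. \<pi> (fst z, y) * F (y, snd z) \<partial>\<mu>)"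
    by (rule equilibrium_increment[OF F eq])
  have foc: "AE x in \<mu>. q * (\<integral>e. (\<integral>y. \<phi> y * F (y, e) \<partial>\<mu>) \<partial>\<rho>) =
      (\<integral>e. F (x, e) * (\<integral>y. \<phi> y * F (y, e) \<partial>\<mu>) \<partial>\<rho>)
      - (\<integral>e. F (x, e) \<partial>\<rho>) * (\<integral>e. (\<integral>y. \<phi> y * F (y, e) \<partial>\<mu>) \<partial>\<rho>)"
    if "\<phi> \<in> borel_measurable \<mu>" "\<And>x. \<bar>\<phi> x\<bar> \<le> K" for \<phi> K
    using first_order_condition[OF F eq, of \<phi> K] that by simp
  define g where "g e = (\<integral>y. F (y, e) \<partial>\<mu>)" for e
  have gm [measurable]: "g \<in> borel_measurable borel"
    unfolding g_def by measurable
  have Fg: "AE z in \<mu> \<Otimes>\<^sub>M \<rho>. F z = g (snd z)"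
    unfolding g_def
    by (rule \<mu>\<rho>.eq_average_if_first_order_condition[OF F, of q]) (use q_pos in simp, rule foc)
  have "AE e in \<rho>. AE y in \<mu>. F (y, e) = g e"
    using AE_\<rho>\<mu>_swap[OF _ Fg] by simp
  then have G: "AE e in \<rho>. \<forall>x. (\<integral>y. \<pi> (x, y) * F (y, e) \<partial>\<mu>) = holdings x * g e"
  proof eventually_elim
    case (elim e)
    show ?case
    proof
      fix x
      have "(\<integral>y. \<pi> (x, y) * F (y, e) \<partial>\<mu>) = (\<integral>y. \<pi> (x, y) * g e \<partial>\<mu>)"
        by (intro integral_cong_AE) (use elim in \<open>auto elim!: eventually_mono\<close>)
      then show "(\<integral>y. \<pi> (x, y) * F (y, e) \<partial>\<mu>) = holdings x * g e"
        by (simp add: holdings_def)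
    qed
  qed
  \<comment> \<open>With \<open>F\<close> replaced by \<open>g\<close>, the Fredholm equation separates the variables.\<close>
  define k where "k x = held x - holdings x" for x
  have key: "AE x in \<mu>. AE e in \<rho>. k x * g e = b x + \<sigma>0 x * e"
    using \<mu>\<rho>.AE_pair[OF fred] \<mu>\<rho>.AE_pair[OF Fg]
  proof eventually_elim
    case (elim x)
    from elim G show ?case
      by eventually_elim (simp add: k_def algebra_simps)
  qed
  have nz_\<sigma>0': "AE x in \<mu>. \<sigma>0 x \<noteq> 0"
    using nz_\<sigma>0 by (subst AE_distr_iff) simp_all
  have FOC1: "AE x in \<mu>. q * (\<integral>e. g e \<partial>\<rho>) = (\<integral>e. F (x, e) * g e \<partial>\<rho>) - (\<integral>e. F (x, e) \<partial>\<rho>) * (\<integral>e. g e \<partial>\<rho>)"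
    using foc[of "\<lambda>_. 1" 1] by (simp add: g_def)
  have "AE x in \<mu>. \<sigma>0 x \<noteq> 0 \<and> (AE e in \<rho>. k x * g e = b x + \<sigma>0 x * e) \<and>
      q * (\<integral>e. g e \<partial>\<rho>) = (\<integral>e. (g e)\<^sup>2 \<partial>\<rho>) - (\<integral>e. g e \<partial>\<rho>)\<^sup>2"
    using nz_\<sigma>0' key FOC1 \<mu>\<rho>.AE_pair[OF Fg]
  proof eventually_elim
    case (elim x)
    have "(\<integral>e. F (x, e) * g e \<partial>\<rho>) = (\<integral>e. (g e)\<^sup>2 \<partial>\<rho>)"
      by (intro integral_cong_AE) (use elim(4) in \<open>auto simp: power2_eq_square elim!: eventually_mono\<close>)
    moreover have "(\<integral>e. F (x, e) \<partial>\<rho>) = (\<integral>e. g e \<partial>\<rho>)"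
      by (intro integral_cong_AE) (use elim(4) in \<open>auto elim!: eventually_mono\<close>)
    ultimately show ?case
      using elim by (simp add: power2_eq_square)
  qed
  then obtain x0 where x0: "\<sigma>0 x0 \<noteq> 0" "AE e in \<rho>. k x0 * g e = b x0 + \<sigma>0 x0 * e"
    and var: "q * (\<integral>e. g e \<partial>\<rho>) = (\<integral>e. (g e)\<^sup>2 \<partial>\<rho>) - (\<integral>e. g e \<partial>\<rho>)\<^sup>2"
    using eventually_happens'[OF \<mu>.ae_filter_bot] by blast
  have "k x0 \<noteq> 0"
  proof
    assume "k x0 = 0"
    then have "AE e in \<rho>. b x0 + \<sigma>0 x0 * e = 0" using x0(2) by simp
    from \<rho>.standardized_AE_affine_zero[OF noise_\<rho> this] x0(1) show False by simp
  qed
  define \<alpha> where "\<alpha> = b x0 / k x0"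
  define \<gamma> where "\<gamma> = \<sigma>0 x0 / k x0"
  have "\<gamma> \<noteq> 0" using x0(1) \<open>k x0 \<noteq> 0\<close> by (simp add: \<gamma>_def)
  have g: "AE e in \<rho>. g e = \<alpha> + \<gamma> * e"
    using x0(2) by eventually_elim (use \<open>k x0 \<noteq> 0\<close> in \<open>simp add: \<alpha>_def \<gamma>_def field_simps\<close>)
  have k: "AE x in \<mu>. b x = k x * \<alpha> \<and> \<sigma>0 x = k x * \<gamma>"
    using key
  proof eventually_elim
    case (elim x)
    from elim g have "AE e in \<rho>. (k x * \<alpha> - b x) + (k x * \<gamma> - \<sigma>0 x) * e = 0"
      by eventually_elim (simp add: algebra_simps)
    from \<rho>.standardized_AE_affine_zero[OF noise_\<rho> this] show ?case by simp
  qed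
  have "m = (\<integral>x. k x * \<alpha> \<partial>\<mu>)"
    unfolding m_def by (intro integral_cong_AE) (use k in \<open>auto simp: k_def elim!: eventually_mono\<close>)
  also have "\<dots> = \<alpha>"
    using integral_held_minus_holdings by (simp add: k_def)
  finally have m: "m = \<alpha>" .
  have "(\<integral>e. g e \<partial>\<rho>) = (\<integral>e. \<alpha> + \<gamma> * e \<partial>\<rho>)"
    by (intro integral_cong_AE) (use g in auto)
  also have "\<dots> = \<alpha>"
    by (rule \<rho>.standardized_affine_moments(1)[OF noise_\<rho>])
  finally have I1: "(\<integral>e. g e \<partial>\<rho>) = \<alpha>" .
  have "(\<integral>e. (g e)\<^sup>2 \<partial>\<rho>) = (\<integral>e. (\<alpha> + \<gamma> * e)\<^sup>2 \<partial>\<rho>)"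
    by (intro integral_cong_AE) (use g in \<open>auto elim!: eventually_mono\<close>)
  also have "\<dots> = \<alpha>\<^sup>2 + \<gamma>\<^sup>2"
    by (rule \<rho>.standardized_affine_moments(2)[OF noise_\<rho>])
  finally have q\<alpha>: "q * \<alpha> = \<gamma>\<^sup>2"
    using var I1 by simp
  then have "\<alpha> > 0"
    using q_pos \<open>\<gamma> \<noteq> 0\<close> by (metis zero_less_mult_pos zero_less_power2)
  show thesis
  proof
    show "m > 0" using \<open>\<alpha> > 0\<close> m by simp
    show "(\<gamma> / m)\<^sup>2 = q / m"
      using q\<alpha> \<open>\<alpha> > 0\<close> by (simp add: m field_simps power2_eq_square)
    show "AE x in \<mu>. \<sigma>0 x = \<gamma> / m * b x"
      using k by eventually_elim (use \<open>\<alpha> > 0\<close> in \<open>simp add: m\<close>)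
    show "AE x in \<mu>. held x \<noteq> 0 \<and> held x - holdings x = b x / m"
      using k nz by eventually_elim (use \<open>\<alpha> > 0\<close> in \<open>simp add: m k_def\<close>)
    have "AE x in \<mu>. AE e in \<rho>. F (x, e) = m * (1 + \<gamma> / m * e)"
      using \<mu>\<rho>.AE_pair[OF Fg]
    proof eventually_elim
      case (elim x)
      from elim g show ?case
        by eventually_elim (use \<open>\<alpha> > 0\<close> in \<open>simp add: m field_simps\<close>)
    qed
    moreover have "{z \<in> space (\<mu> \<Otimes>\<^sub>M \<rho>). F z = m * (1 + \<gamma> / m * snd z)} \<in> sets (\<mu> \<Otimes>\<^sub>M \<rho>)"
      by measurable
    ultimately show "AE z in \<mu> \<Otimes>\<^sub>M \<rho>. F z = m * (1 + \<gamma> / m * snd z)"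
      by (intro \<mu>\<rho>.AE_pair_measure) simp_all
  qed
qed

section \<open>Construction of an equilibrium\<close>

text \<open>As \<open>\<sigma>0 = \<lambda> b\<close>, all terms but the idiosyncratic one carry the same factor \<open>1 + \<lambda> eps0\<close>.\<close>

lemma affine_environment_increment:
  fixes \<beta> :: "real \<times> real \<Rightarrow> real"
  assumes \<beta> [measurable]: "\<beta> \<in> borel_measurable (borel \<Otimes>\<^sub>M borel)"
    and colin: "AE x in \<mu>. \<sigma>0 x = lam * b x"
    and inc: "is_inc (\<lambda>z. m * (1 + lam * snd z)) \<beta> D"
  defines "k \<equiv> \<lambda>x. (b x + m * (\<integral>y. \<beta> (x, y) \<partial>\<mu>)) / held x"
  shows "AE \<omega> in M. D \<omega> = (1 + lam * eps0 \<omega>) * k (X0 \<omega>) + \<sigma> (X0 \<omega>) / held (X0 \<omega>) * eps \<omega>"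
proof -
  have "(\<lambda>z. m * (1 + lam * snd z)) \<in> borel_measurable (borel \<Otimes>\<^sub>M borel)"
    by measurable
  from increment_form(2)[OF this \<beta> inc] AE_\<mu>[OF colin]
  show ?thesis
  proof eventually_elim
    case (elim \<omega>)
    have "b (X0 \<omega>) + \<sigma>0 (X0 \<omega>) * eps0 \<omega> + (\<integral>y. \<beta> (X0 \<omega>, y) * (m * (1 + lam * snd (y, eps0 \<omega>))) \<partial>\<mu>)
      = (1 + lam * eps0 \<omega>) * (b (X0 \<omega>) + m * (\<integral>y. \<beta> (X0 \<omega>, y) \<partial>\<mu>))"
    proof -
      have "(\<integral>y. \<beta> (X0 \<omega>, y) * (m * (1 + lam * snd (y, eps0 \<omega>))) \<partial>\<mu>)
        = m * (1 + lam * eps0 \<omega>) * (\<integral>y. \<beta> (X0 \<omega>, y) \<partial>\<mu>)"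
        by simp
      then show ?thesis
        using elim(2) by (simp add: algebra_simps)
    qed
    with elim(1) show ?case
      by (simp add: k_def)
  qed
qed

text \<open>The value \<open>\<lambda>\<^sup>2 = q / m\<close> turns the variance penalty \<open>\<lambda>\<^sup>2 k\<^sup>2 / (2q)\<close> into \<open>k\<^sup>2 / (2m)\<close>. Completing the square
  in \<open>k - k\<^sup>2 / (2m)\<close> isolates the only term that depends on the strategy.\<close>

lemma affine_environment_mean_variance:
  fixes \<beta> :: "real \<times> real \<Rightarrow> real"
  assumes \<beta> [measurable]: "\<beta> \<in> borel_measurable (borel \<Otimes>\<^sub>M borel)"
    and m: "m > 0" and lam: "lam\<^sup>2 = q / m"
    and colin: "AE x in \<mu>. \<sigma>0 x = lam * b x"
    and inc: "is_inc (\<lambda>z. m * (1 + lam * snd z)) \<beta> D"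
  defines "k \<equiv> \<lambda>x. (b x + m * (\<integral>y. \<beta> (x, y) \<partial>\<mu>)) / held x"
  shows "AE \<omega> in M. mean_variance M X0 q (\<lambda>\<omega>. X0 \<omega> + D \<omega>) \<omega>
    = X0 \<omega> + m / 2 - (k (X0 \<omega>) - m)\<^sup>2 / (2 * m) - (\<sigma> (X0 \<omega>) / held (X0 \<omega>))\<^sup>2 / (2 * q)"
proof -
  have [measurable]: "k \<in> borel_measurable borel"
    unfolding k_def by measurable
  from inc have [measurable]: "D \<in> borel_measurable M"
    by (simp add: is_increment_def)
  define h where "h = (\<lambda>z. (fst z + k (fst z)) + (lam * k (fst z)) * snd z)"
  have h: "h \<in> borel_measurable (borel \<Otimes>\<^sub>M borel)"
    unfolding h_def by measurable
  have s: "(\<lambda>x. \<sigma> x / held x) \<in> borel_measurable borel"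
    by measurable
  have I1: "(\<integral>e. h (x, e) \<partial>\<rho>) = x + k x" for x
    unfolding h_def fst_conv snd_conv by (rule \<rho>.standardized_affine_moments(1)[OF noise_\<rho>])
  have I2: "(\<integral>e. (h (x, e))\<^sup>2 \<partial>\<rho>) = (x + k x)\<^sup>2 + (lam * k x)\<^sup>2" for x
    unfolding h_def fst_conv snd_conv by (rule \<rho>.standardized_affine_moments(2)[OF noise_\<rho>])
  have L2h: "AE x in \<mu>. L2 \<rho> (\<lambda>e. h (x, e))"
  proof (rule AE_I2)
    fix x
    show "L2 \<rho> (\<lambda>e. h (x, e))"
      using L2_add[OF \<rho>.L2_const[of "x + k x"] L2_cmult[OF noise_\<rho>(1), of "lam * k x"]]
      by (simp add: h_def)
  qed
  have "AE \<omega> in M. X0 \<omega> + D \<omega> = h (X0 \<omega>, eps0 \<omega>) + \<sigma> (X0 \<omega>) / held (X0 \<omega>) * eps \<omega>"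
  proof -
    have "AE \<omega> in M. D \<omega> = (1 + lam * eps0 \<omega>) * k (X0 \<omega>) + \<sigma> (X0 \<omega>) / held (X0 \<omega>) * eps \<omega>"
      using affine_environment_increment[OF \<beta> colin inc] by (simp add: k_def)
    then show ?thesis
      by eventually_elim (simp add: h_def algebra_simps)
  qed
  moreover have "(\<lambda>\<omega>. X0 \<omega> + D \<omega>) \<in> borel_measurable M"
    by measurable
  ultimately have "AE \<omega> in M. mean_variance M X0 q (\<lambda>\<omega>. X0 \<omega> + D \<omega>) \<omega> = (\<integral>e. h (X0 \<omega>, e) \<partial>\<rho>)
    - 1 / (2 * q) * ((\<integral>e. (h (X0 \<omega>, e))\<^sup>2 \<partial>\<rho>) - (\<integral>e. h (X0 \<omega>, e) \<partial>\<rho>)\<^sup>2 + (\<sigma> (X0 \<omega>) / held (X0 \<omega>))\<^sup>2)"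
    by (intro mean_variance_affine_noise[OF h s L2h])
  then
  show ?thesis
  proof eventually_elim
    case (elim \<omega>)
    let ?k = "k (X0 \<omega>)"
    have "(lam * ?k)\<^sup>2 = q / m * ?k\<^sup>2"
      using lam by (simp add: power_mult_distrib)
    then have var: "(\<integral>e. (h (X0 \<omega>, e))\<^sup>2 \<partial>\<rho>) - (\<integral>e. h (X0 \<omega>, e) \<partial>\<rho>)\<^sup>2 = q / m * ?k\<^sup>2"
      unfolding I1 I2 by simp
    define S where "S = (\<sigma> (X0 \<omega>) / held (X0 \<omega>))\<^sup>2"
    have "mean_variance M X0 q (\<lambda>\<omega>. X0 \<omega> + D \<omega>) \<omega> = X0 \<omega> + ?k - 1 / (2 * q) * (q / m * ?k\<^sup>2 + S)"
      using elim unfolding var unfolding I1 S_def .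
    also have "\<dots> = X0 \<omega> + m / 2 - (?k - m)\<^sup>2 / (2 * m) - S / (2 * q)"
      using m q_pos by (simp add: field_simps power2_eq_square)
    finally show ?case
      unfolding S_def .
  qed
qed

text \<open>The balance condition says that \<open>\<pi>\<close> attains \<open>k = m\<close>, so the square in the criterion vanishes for \<open>\<pi>\<close>
  and the common part of its increment is the environment itself. The integrability of \<open>\<sigma> / held\<close> makes
  the increment square integrable.\<close>

lemma affine_equilibrium:
  assumes m: "m > 0" and lam: "lam\<^sup>2 = q / m"
    and colin: "AE x in \<mu>. \<sigma>0 x = lam * b x"
    and bal: "AE x in \<mu>. held x \<noteq> 0 \<and> b x + m * holdings x = m * held x"
    and L2X: "L2 M X0" and L2s: "L2 \<mu> (\<lambda>x. \<sigma> x / held x)"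
  defines "F \<equiv> \<lambda>z. m * (1 + lam * snd z)"
  shows "L2 (\<mu> \<Otimes>\<^sub>M \<rho>) F" "equilibrium F" "fredholm_solution \<mu> \<rho> b \<sigma>0 \<pi> F"
proof -
  have [measurable]: "F \<in> borel_measurable (borel \<Otimes>\<^sub>M borel)"
    unfolding F_def by measurable
  have "L2 \<rho> (\<lambda>e. m * (1 + lam * e))"
    using L2_cmult[OF L2_add[OF \<rho>.L2_const L2_cmult[OF noise_\<rho>(1)]]] .
  from \<mu>\<rho>.L2_comp_snd[OF this] show L2F: "L2 (\<mu> \<Otimes>\<^sub>M \<rho>) F"
    by (simp add: F_def)
  have F_integral: "(\<integral>y. \<pi> (x, y) * F (y, e) \<partial>\<mu>) = m * (1 + lam * e) * holdings x" for x e
    by (simp add: F_def holdings_def)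
  define s where "s x = \<sigma> x / held x" for x
  have [measurable]: "s \<in> borel_measurable borel"
    unfolding s_def by measurable
  define D where "D \<omega> = m * (1 + lam * eps0 \<omega>) + s (X0 \<omega>) * eps \<omega>" for \<omega>
  have [measurable]: "D \<in> borel_measurable M"
    unfolding D_def by measurable
  have inc: "is_inc F \<pi> D"
    unfolding is_increment_def held_def[symmetric]
  proof (intro conjI)
    show "AE \<omega> in M. integrable \<mu> (\<lambda>y. \<pi> (X0 \<omega>, y) * F (y, eps0 \<omega>))"
      using \<pi>_section_integrable by eventually_elim (simp add: F_def)
    show "AE \<omega> in M. held (X0 \<omega>) * D \<omega> = b (X0 \<omega>) + \<sigma> (X0 \<omega>) * eps \<omega> + \<sigma>0 (X0 \<omega>) * eps0 \<omega>
        + (\<integral>y. \<pi> (X0 \<omega>, y) * F (y, eps0 \<omega>) \<partial>\<mu>)"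
      using AE_\<mu>[OF bal] AE_\<mu>[OF colin]
    proof eventually_elim
      case (elim \<omega>)
      have "held (X0 \<omega>) * D \<omega> = (m * held (X0 \<omega>)) * (1 + lam * eps0 \<omega>) + \<sigma> (X0 \<omega>) * eps \<omega>"
        using elim by (simp add: D_def s_def field_simps)
      also have "m * held (X0 \<omega>) = b (X0 \<omega>) + m * holdings (X0 \<omega>)"
        using elim by simp
      finally show ?case
        unfolding fst_conv snd_conv F_integral using elim(2) by (simp add: algebra_simps)
    qed
  qed (use \<pi>_integrable in simp_all)
  have "L2 (\<mu> \<Otimes>\<^sub>M \<nu>) (\<lambda>z. s (fst z) * snd z)"
    using \<mu>\<nu>.L2_prod[OF L2s noise_\<nu>(1)] by (simp add: s_def)
  then have "L2 M (\<lambda>\<omega>. s (X0 \<omega>) * eps \<omega>)"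
    by (subst (asm) L2_\<mu>\<nu>_iff) simp_all
  moreover have "L2 M (\<lambda>\<omega>. m * (1 + lam * eps0 \<omega>))"
    using L2_\<mu>\<rho>_iff[of F] L2F by (simp add: F_def)
  ultimately have "L2 M (\<lambda>\<omega>. X0 \<omega> + D \<omega>)"
    unfolding D_def by (intro L2_add L2X)
  with inc have adm: "\<pi> \<in> admissible M X0 eps eps0 b \<sigma> \<sigma>0 F \<pi>"
    by (auto simp: admissible_def cross_holding_strategy_def)
  have k\<pi>: "AE \<omega> in M. (b (X0 \<omega>) + m * holdings (X0 \<omega>)) / held (X0 \<omega>) = m"
    using AE_\<mu>[OF bal] by eventually_elim simp
  show "equilibrium F"
    unfolding mean_field_equilibrium_def
  proof (intro conjI allI impI ballI)
    show "integrable (\<mu> \<Otimes>\<^sub>M \<rho>) F"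
      using L2F by (rule \<mu>\<rho>.P.L2_integrable)
    show "\<pi> \<in> admissible M X0 eps eps0 b \<sigma> \<sigma>0 F \<pi>" by (rule adm)
    fix D assume inc: "is_inc F \<pi> D"
    have D: "AE \<omega> in M. D \<omega> = F (X0 \<omega>, eps0 \<omega>) + s (X0 \<omega>) * eps \<omega>"
      using affine_environment_increment[OF measurable_\<pi> colin inc[unfolded F_def]] k\<pi>
    proof eventually_elim
      case (elim \<omega>)
      have "D \<omega> = (1 + lam * eps0 \<omega>) * m + \<sigma> (X0 \<omega>) / held (X0 \<omega>) * eps \<omega>"
        using elim(1) unfolding holdings_def[symmetric] elim(2) .
      then show ?case by (simp add: F_def s_def)
    qed
    show "AE \<omega> in M. real_cond_exp M (sigma_gen M (\<lambda>\<omega>. (X0 \<omega>, eps0 \<omega>))) D \<omega> = F (X0 \<omega>, eps0 \<omega>)"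
      by (rule cond_exp_affine_noise[OF _ _ _ D]) (use inc in \<open>auto simp: is_increment_def\<close>)
    fix \<beta> D' assume "\<beta> \<in> admissible M X0 eps eps0 b \<sigma> \<sigma>0 F \<pi>" and inc': "is_inc F \<beta> D'"
    then have \<beta>: "\<beta> \<in> borel_measurable (borel \<Otimes>\<^sub>M borel)"
      by (simp add: admissible_def cross_holding_strategy_def)
    show "AE \<omega> in M. mean_variance M X0 q (\<lambda>\<omega>. X0 \<omega> + D' \<omega>) \<omega> \<le> mean_variance M X0 q (\<lambda>\<omega>. X0 \<omega> + D \<omega>) \<omega>"
      using affine_environment_mean_variance[OF \<beta> m lam colin inc'[unfolded F_def]]
        affine_environment_mean_variance[OF measurable_\<pi> m lam colin inc[unfolded F_def]] k\<pi>
    proof eventually_elim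
      case (elim \<omega>)
      have "0 \<le> ((b (X0 \<omega>) + m * (\<integral>y. \<beta> (X0 \<omega>, y) \<partial>\<mu>)) / held (X0 \<omega>) - m)\<^sup>2 / (2 * m)"
        using m by simp
      then show ?case
        using elim by (simp add: holdings_def)
    qed
  qed
  show "fredholm_solution \<mu> \<rho> b \<sigma>0 \<pi> F"
    unfolding fredholm_solution_def held_def[symmetric]
  proof (intro conjI L2F)
    have "AE z in \<mu> \<Otimes>\<^sub>M \<rho>. held (fst z) * F z = b (fst z) + \<sigma>0 (fst z) * snd z + (\<integral>y. \<pi> (fst z, y) * F (y, snd z) \<partial>\<mu>)"
    proof (subst AE_\<mu>\<rho>_iff)
      show "AE \<omega> in M. held (fst (X0 \<omega>, eps0 \<omega>)) * F (X0 \<omega>, eps0 \<omega>) =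
          b (fst (X0 \<omega>, eps0 \<omega>)) + \<sigma>0 (fst (X0 \<omega>, eps0 \<omega>)) * snd (X0 \<omega>, eps0 \<omega>) +
          (\<integral>y. \<pi> (fst (X0 \<omega>, eps0 \<omega>), y) * F (y, snd (X0 \<omega>, eps0 \<omega>)) \<partial>\<mu>)"
        using AE_\<mu>[OF bal] AE_\<mu>[OF colin]
      proof eventually_elim
        case (elim \<omega>)
        have "held (X0 \<omega>) * F (X0 \<omega>, eps0 \<omega>) = (m * held (X0 \<omega>)) * (1 + lam * eps0 \<omega>)"
          by (simp add: F_def)
        also have "m * held (X0 \<omega>) = b (X0 \<omega>) + m * holdings (X0 \<omega>)"
          using elim by simp
        finally show ?case
          unfolding fst_conv snd_conv F_integral using elim(2) by (simp add: algebra_simps)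
      qed
    qed measurable
    then show "AE (x, e) in \<mu> \<Otimes>\<^sub>M \<rho>. held x * F (x, e) = b x + \<sigma>0 x * e + (\<integral>y. \<pi> (x, y) * F (y, e) \<partial>\<mu>)"
      by (simp add: split_beta')
  qed
qed

end

section \<open>The characterization\<close>

theorem theorem2p5:
  fixes M :: "'a measure"
    and X0 eps eps0 :: "'a \<Rightarrow> real"
    and b \<sigma> \<sigma>0 :: "real \<Rightarrow> real"
    and q m :: real
    and \<pi> :: "real \<times> real \<Rightarrow> real"
    and \<mu>0 \<rho> :: "real measure"
  assumes "prob_space M"
    and "prob_space.indep_vars M (\<lambda>_. borel) (\<lambda>i. [X0, eps, eps0] ! i) {0, 1, 2}"
    and "integrable M (\<lambda>\<omega>. (eps \<omega>)\<^sup>2)" "(\<integral>\<omega>. eps \<omega> \<partial>M) = 0" "(\<integral>\<omega>. (eps \<omega>)\<^sup>2 \<partial>M) = 1"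
    and "integrable M (\<lambda>\<omega>. (eps0 \<omega>)\<^sup>2)" "(\<integral>\<omega>. eps0 \<omega> \<partial>M) = 0" "(\<integral>\<omega>. (eps0 \<omega>)\<^sup>2 \<partial>M) = 1"
    and "b \<in> borel_measurable borel" "bounded (range b)"
    and "\<sigma> \<in> borel_measurable borel" "bounded (range \<sigma>)"
    and "\<sigma>0 \<in> borel_measurable borel" "bounded (range \<sigma>0)"
    and "AE \<omega> in M. \<sigma> (X0 \<omega>) \<noteq> 0" "AE \<omega> in M. \<sigma>0 (X0 \<omega>) \<noteq> 0"
    and "\<mu>0 = distr M borel X0" and "\<rho> = distr M borel eps0"
    and "q > 0"
    and "L2 (\<mu>0 \<Otimes>\<^sub>M \<mu>0) \<pi>"
    and "m = (\<integral>\<omega>. b (X0 \<omega>) \<partial>M)"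
  shows "((\<exists>F. L2 (\<mu>0 \<Otimes>\<^sub>M \<rho>) F \<and>
               mean_field_equilibrium M X0 eps eps0 b \<sigma> \<sigma>0 q F \<pi> \<and>
               fredholm_unique_solution \<mu>0 \<rho> b \<sigma>0 \<pi>)
          \<longleftrightarrow>
          (m > 0 \<and>
           (\<exists>lam. (lam = sqrt (q / m) \<or> lam = - sqrt (q / m)) \<and> (AE x in \<mu>0. \<sigma>0 x = lam * b x)) \<and>
           fredholm_uniqueness \<mu>0 \<rho> b \<sigma>0 \<pi> \<and>
           (AE x in \<mu>0. 0 \<noteq> (\<integral>y. \<pi> (x, y) \<partial>\<mu>0) + b x / m \<and>
                        (\<integral>y. \<pi> (x, y) \<partial>\<mu>0) + b x / m = 1 + (\<integral>y. \<pi> (y, x) \<partial>\<mu>0)) \<and>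
           L2 M X0 \<and> L2 \<mu>0 (\<lambda>x. \<sigma> x / (1 + (\<integral>y. \<pi> (y, x) \<partial>\<mu>0)))))
         \<and>
         (\<forall>F lam. L2 (\<mu>0 \<Otimes>\<^sub>M \<rho>) F \<longrightarrow>
               mean_field_equilibrium M X0 eps eps0 b \<sigma> \<sigma>0 q F \<pi> \<longrightarrow>
               fredholm_unique_solution \<mu>0 \<rho> b \<sigma>0 \<pi> \<longrightarrow>
               (lam = sqrt (q / m) \<or> lam = - sqrt (q / m)) \<longrightarrow>
               (AE x in \<mu>0. \<sigma>0 x = lam * b x) \<longrightarrow>
               (AE (x, e) in \<mu>0 \<Otimes>\<^sub>M \<rho>. F (x, e) = m * (1 + lam * e)))"
    (is "(?ex \<longleftrightarrow> ?cond) \<and> ?form")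
proof -
  interpret prob_space M by fact
  interpret one_period M X0 eps eps0 b \<sigma> \<sigma>0 q \<pi>
    by unfold_locales (use assms in simp_all)
  have \<mu>0: "\<mu>0 = \<mu>" and \<rho>: "\<rho> = distr M borel eps0" by fact+
  have m: "m = (\<integral>x. b x \<partial>\<mu>)"
    using assms by (simp add: integral_distr)
  have root: "lam\<^sup>2 = q / m \<longleftrightarrow> lam = sqrt (q / m) \<or> lam = - sqrt (q / m)" if "m > 0" for lam
  proof -
    have "q / m = (sqrt (q / m))\<^sup>2" using that q_pos by simp
    then show ?thesis by (metis power2_eq_iff)
  qed
  have ?cond if ex: ?ex
  proof -
    from ex obtain F where F: "L2 (\<mu> \<Otimes>\<^sub>M distr M borel eps0) F" "equilibrium F"
      and uniq: "fredholm_unique_solution \<mu>0 \<rho> b \<sigma>0 \<pi>"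
      unfolding \<mu>0 \<rho> by blast
    obtain lam where lam: "m > 0" "lam\<^sup>2 = q / m" "AE x in \<mu>. \<sigma>0 x = lam * b x"
      and bal: "AE x in \<mu>. held x \<noteq> 0 \<and> held x - holdings x = b x / m"
      by (rule equilibrium_structure[OF F, folded m]) (rule that)
    have "AE x in \<mu>. 0 \<noteq> (\<integral>y. \<pi> (x, y) \<partial>\<mu>) + b x / m \<and>
        (\<integral>y. \<pi> (x, y) \<partial>\<mu>) + b x / m = 1 + (\<integral>y. \<pi> (y, x) \<partial>\<mu>)"
      using bal unfolding held_def[symmetric] holdings_def[symmetric]
      by eventually_elim auto
    then show ?cond
      using lam root[OF lam(1)] uniq equilibrium_imp_L2[OF F]
      unfolding \<mu>0 held_def[symmetric] fredholm_unique_solution_def by blast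
  qed
  moreover have ?ex if cond: ?cond
  proof -
    from cond obtain lam where "m > 0" and lam: "lam\<^sup>2 = q / m" "AE x in \<mu>. \<sigma>0 x = lam * b x"
      using root unfolding \<mu>0 by blast
    from cond have "AE x in \<mu>. 0 \<noteq> holdings x + b x / m \<and> holdings x + b x / m = held x"
      unfolding held_def holdings_def \<mu>0 by blast
    then have bal: "AE x in \<mu>. held x \<noteq> 0 \<and> b x + m * holdings x = m * held x"
      by eventually_elim (use \<open>m > 0\<close> in \<open>auto simp: field_simps\<close>)
    have "L2 M X0" "L2 \<mu> (\<lambda>x. \<sigma> x / held x)"
      using cond unfolding held_def \<mu>0 by blast+
    from affine_equilibrium[OF \<open>m > 0\<close> lam bal this] cond
    show ?ex
      unfolding \<mu>0 \<rho> fredholm_unique_solution_def by blast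
  qed
  moreover have ?form
  proof (intro allI impI)
    fix F lam
    assume "L2 (\<mu>0 \<Otimes>\<^sub>M \<rho>) F" and eqF: "equilibrium F" and lam: "AE x in \<mu>0. \<sigma>0 x = lam * b x"
    then have L2F: "L2 (\<mu> \<Otimes>\<^sub>M distr M borel eps0) F"
      unfolding \<mu>0 \<rho> by blast
    obtain lam' where lam': "AE x in \<mu>. \<sigma>0 x = lam' * b x"
      and F: "AE z in \<mu> \<Otimes>\<^sub>M distr M borel eps0. F z = m * (1 + lam' * snd z)"
      by (rule equilibrium_structure[OF L2F eqF, folded m]) (rule that)
    \<comment> \<open>The factor is determined by \<open>\<sigma>0 = lam b\<close>, because \<open>\<sigma>0(X0) \<noteq> 0\<close> excludes \<open>b(X0) = 0\<close>.\<close>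
    have "AE \<omega> in M. lam = lam'"
      using AE_\<mu>[OF lam[unfolded \<mu>0]] AE_\<mu>[OF lam'] nz_\<sigma>0 by eventually_elim auto
    then have "lam = lam'" by simp
    then show "AE (x, e) in \<mu>0 \<Otimes>\<^sub>M \<rho>. F (x, e) = m * (1 + lam * e)"
      unfolding \<mu>0 \<rho> split_beta' using F by simp
  qed
  ultimately show ?thesis by blast
qed

end
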